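(* The variety $\mathcal{V}_{\sigma\ell\mathbb{G}_u}$ is generated by $\mathbb{R}$: every $G\in\mathcal{V}_{\sigma\ell\mathbb{G}_u}$ is isomorphic to a subalgebra of a quotient of a power of the algebra $(\mathbb{R},0,+,-,\vee,\wedge,\bigvee^-,1)$, where in $\mathbb{R}$ one sets $\bigvee^-(g,f_1,f_2,\dots)=\sup_{n\ge1}\{f_n\wedge g\}$ and $1$ is the real number $1$.
   Context: $\mathcal{V}_{\sigma\ell\mathbb{G}_u}$ is the infinitary variety of algebras $(G,0,+,-,\vee,\wedge,\bigvee^-,1)$, $\bigvee^-$ of countably infinite arity ($\bigvee_{n\ge1}^g f_n:=\bigvee^-(g,f_1,f_2,\dots)$), $1$ a constant, satisfying the $\ell$-group axioms, (A1) $\bigvee_{n\ge1}^g f_n=\bigvee_{n\ge1}^g(f_n\wedge g)$; (A2) $\bigvee_{n\ge1}^g f_n=(f_1\wedge g)\vee\bigvee^-(g,f_2,f_3,\dots)$; (A3) $\bigvee_{n\ge1}^g(f_n\wedge h)\le h$ ($a\le b$ meaning $a\wedge b=a$); and $\bigvee_{n\ge1}^{|f|}(|f|\wedge n1)=|f|$. *)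

theory Defs
  imports Complex_Main
begin

text \<open>Algebras of signature (G, 0, +, -, join, meet, bjoin, 1); bjoin g f stands for
  the countably-infinitary operation with arguments (g, f_1, f_2, ...), where the
  sequence f_1, f_2, ... is encoded as f 0, f 1, ... .\<close>

record 'a sgu =
  sg_carrier :: "'a set"
  sg_zero :: 'a
  sg_add :: "'a \<Rightarrow> 'a \<Rightarrow> 'a"
  sg_neg :: "'a \<Rightarrow> 'a"
  sg_join :: "'a \<Rightarrow> 'a \<Rightarrow> 'a"
  sg_meet :: "'a \<Rightarrow> 'a \<Rightarrow> 'a"
  sg_bjoin :: "'a \<Rightarrow> (nat \<Rightarrow> 'a) \<Rightarrow> 'a"
  sg_one :: 'a

definition sg_le :: "('a, 'b) sgu_scheme \<Rightarrow> 'a \<Rightarrow> 'a \<Rightarrow> bool" where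
  "sg_le G a b \<longleftrightarrow> sg_meet G a b = a"

definition sg_abs :: "('a, 'b) sgu_scheme \<Rightarrow> 'a \<Rightarrow> 'a" where
  "sg_abs G f = sg_join G f (sg_neg G f)"

fun sg_nat :: "('a, 'b) sgu_scheme \<Rightarrow> nat \<Rightarrow> 'a" where
  "sg_nat G 0 = sg_zero G"
| "sg_nat G (Suc n) = sg_add G (sg_nat G n) (sg_one G)"

definition sg_closed :: "('a, 'b) sgu_scheme \<Rightarrow> 'a set \<Rightarrow> bool" where
  "sg_closed G C \<longleftrightarrow>
     sg_zero G \<in> C \<and> sg_one G \<in> C \<and>
     (\<forall>x\<in>C. \<forall>y\<in>C. sg_add G x y \<in> C \<and> sg_join G x y \<in> C \<and> sg_meet G x y \<in> C) \<and>
     (\<forall>x\<in>C. sg_neg G x \<in> C) \<and>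
     (\<forall>g\<in>C. \<forall>f. range f \<subseteq> C \<longrightarrow> sg_bjoin G g f \<in> C)"

definition in_V :: "('a, 'b) sgu_scheme \<Rightarrow> bool" where
  "in_V G \<longleftrightarrow> sg_closed G (sg_carrier G) \<and>
   (let C = sg_carrier G; add = sg_add G; neg = sg_neg G; jn = sg_join G; mt = sg_meet G;
        bj = sg_bjoin G; z = sg_zero G in
    \<comment> \<open>abelian group\<close>
    (\<forall>x\<in>C. \<forall>y\<in>C. \<forall>w\<in>C. add (add x y) w = add x (add y w)) \<and>
    (\<forall>x\<in>C. \<forall>y\<in>C. add x y = add y x) \<and>
    (\<forall>x\<in>C. add x z = x) \<and>
    (\<forall>x\<in>C. add x (neg x) = z) \<and>
    \<comment> \<open>lattice\<close>
    (\<forall>x\<in>C. \<forall>y\<in>C. \<forall>w\<in>C. jn (jn x y) w = jn x (jn y w)) \<and>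
    (\<forall>x\<in>C. \<forall>y\<in>C. \<forall>w\<in>C. mt (mt x y) w = mt x (mt y w)) \<and>
    (\<forall>x\<in>C. \<forall>y\<in>C. jn x y = jn y x) \<and>
    (\<forall>x\<in>C. \<forall>y\<in>C. mt x y = mt y x) \<and>
    (\<forall>x\<in>C. \<forall>y\<in>C. jn x (mt x y) = x) \<and>
    (\<forall>x\<in>C. \<forall>y\<in>C. mt x (jn x y) = x) \<and>
    \<comment> \<open>translation invariance\<close>
    (\<forall>x\<in>C. \<forall>y\<in>C. \<forall>w\<in>C. add x (jn y w) = jn (add x y) (add x w)) \<and>
    (\<forall>x\<in>C. \<forall>y\<in>C. \<forall>w\<in>C. add x (mt y w) = mt (add x y) (add x w)) \<and>
    \<comment> \<open>(A1)\<close>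
    (\<forall>g\<in>C. \<forall>f. range f \<subseteq> C \<longrightarrow> bj g f = bj g (\<lambda>n. mt (f n) g)) \<and>
    \<comment> \<open>(A2)\<close>
    (\<forall>g\<in>C. \<forall>f. range f \<subseteq> C \<longrightarrow> bj g f = jn (mt (f 0) g) (bj g (\<lambda>n. f (Suc n)))) \<and>
    \<comment> \<open>(A3)\<close>
    (\<forall>g\<in>C. \<forall>h\<in>C. \<forall>f. range f \<subseteq> C \<longrightarrow> sg_le G (bj g (\<lambda>n. mt (f n) h)) h) \<and>
    \<comment> \<open>last axiom: bjoin^{|f|}_{n>=1} (|f| meet n1) = |f|\<close>
    (\<forall>f\<in>C. bj (sg_abs G f) (\<lambda>n. mt (sg_abs G f) (sg_nat G (Suc n))) = sg_abs G f))"

definition R_alg :: "real sgu" where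
  "R_alg = \<lparr> sg_carrier = UNIV, sg_zero = 0, sg_add = (+), sg_neg = uminus,
     sg_join = max, sg_meet = min, sg_bjoin = (\<lambda>g f. Sup (range (\<lambda>n. min (f n) g))),
     sg_one = 1 \<rparr>"

definition R_power :: "('t \<Rightarrow> real) sgu" where
  "R_power = \<lparr> sg_carrier = UNIV, sg_zero = (\<lambda>t. 0), sg_add = (\<lambda>x y t. x t + y t),
     sg_neg = (\<lambda>x t. - x t), sg_join = (\<lambda>x y t. max (x t) (y t)),
     sg_meet = (\<lambda>x y t. min (x t) (y t)),
     sg_bjoin = (\<lambda>g f t. sg_bjoin R_alg (g t) (\<lambda>n. f n t)), sg_one = (\<lambda>t. 1) \<rparr>"

definition congruence :: "('a, 'b) sgu_scheme \<Rightarrow> ('a \<times> 'a) set \<Rightarrow> bool" where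
  "congruence A \<theta> \<longleftrightarrow> equiv (sg_carrier A) \<theta> \<and>
    (\<forall>x x' y y'. (x, x') \<in> \<theta> \<longrightarrow> (y, y') \<in> \<theta> \<longrightarrow>
        (sg_add A x y, sg_add A x' y') \<in> \<theta> \<and> (sg_join A x y, sg_join A x' y') \<in> \<theta> \<and>
        (sg_meet A x y, sg_meet A x' y') \<in> \<theta>) \<and>
    (\<forall>x x'. (x, x') \<in> \<theta> \<longrightarrow> (sg_neg A x, sg_neg A x') \<in> \<theta>) \<and>
    (\<forall>g g' f f'. (g, g') \<in> \<theta> \<longrightarrow> (\<forall>n. (f n, f' n) \<in> \<theta>) \<longrightarrow>
        (sg_bjoin A g f, sg_bjoin A g' f') \<in> \<theta>)"

text \<open>Quotient algebra A/theta, carrier = equivalence classes; operations computed on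
  (arbitrarily chosen) representatives, which is well defined for a congruence.\<close>
definition rep :: "'a set \<Rightarrow> 'a" where "rep X = (SOME x. x \<in> X)"

definition quot :: "('a, 'b) sgu_scheme \<Rightarrow> ('a \<times> 'a) set \<Rightarrow> 'a set sgu" where
  "quot A \<theta> = \<lparr> sg_carrier = sg_carrier A // \<theta>,
     sg_zero = \<theta> `` {sg_zero A},
     sg_add = (\<lambda>X Y. \<theta> `` {sg_add A (rep X) (rep Y)}),
     sg_neg = (\<lambda>X. \<theta> `` {sg_neg A (rep X)}),
     sg_join = (\<lambda>X Y. \<theta> `` {sg_join A (rep X) (rep Y)}),
     sg_meet = (\<lambda>X Y. \<theta> `` {sg_meet A (rep X) (rep Y)}),
     sg_bjoin = (\<lambda>X F. \<theta> `` {sg_bjoin A (rep X) (\<lambda>n. rep (F n))}),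
     sg_one = \<theta> `` {sg_one A} \<rparr>"

definition hom :: "('a, 'b) sgu_scheme \<Rightarrow> ('c, 'd) sgu_scheme \<Rightarrow> ('a \<Rightarrow> 'c) \<Rightarrow> bool" where
  "hom G H h \<longleftrightarrow> h ` sg_carrier G \<subseteq> sg_carrier H \<and>
    h (sg_zero G) = sg_zero H \<and> h (sg_one G) = sg_one H \<and>
    (\<forall>x\<in>sg_carrier G. \<forall>y\<in>sg_carrier G.
       h (sg_add G x y) = sg_add H (h x) (h y) \<and>
       h (sg_join G x y) = sg_join H (h x) (h y) \<and>
       h (sg_meet G x y) = sg_meet H (h x) (h y)) \<and>
    (\<forall>x\<in>sg_carrier G. h (sg_neg G x) = sg_neg H (h x)) \<and>
    (\<forall>g\<in>sg_carrier G. \<forall>f. range f \<subseteq> sg_carrier G \<longrightarrow>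
       h (sg_bjoin G g f) = sg_bjoin H (h g) (\<lambda>n. h (f n)))"

text \<open>Isomorphism: bijective homomorphism (its inverse is then automatically a homomorphism).\<close>
definition iso :: "('a, 'b) sgu_scheme \<Rightarrow> ('c, 'd) sgu_scheme \<Rightarrow> ('a \<Rightarrow> 'c) \<Rightarrow> bool" where
  "iso G H h \<longleftrightarrow> hom G H h \<and> bij_betw h (sg_carrier G) (sg_carrier H)"

definition subalg :: "'c set \<Rightarrow> ('c, 'd) sgu_scheme \<Rightarrow> bool" where
  "subalg C H \<longleftrightarrow> C \<subseteq> sg_carrier H \<and> sg_closed H C"

end

theory Submission
  imports Defs "HOL-Library.Countable_Set"
begin

text \<open>The idea is that of Rasiowa and Sikorski, with Baire category replaced by a generic sequence.
  In an algebra of the variety the operation \<open>bjoin\<close> computes countable suprema and \<open>1\<close> is a weak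
  unit. A positive element \<open>c \<noteq> 0\<close> is regarded as a nonempty set \<open>{c > 0}\<close>, which can be shrunk to
  decide the sign of an element, to bound it by a multiple of \<open>1\<close>, or to bring one of the terms of a
  countable supremum close to the supremum. Meeting countably many such requirements along a
  decreasing sequence yields a total order on a countable subgroup, hence, by the argument of
  Hoelder, a real valuation that respects the operations there together with countably many
  prescribed suprema, and that can be kept positive at a given \<open>d \<noteq> 0\<close>. Consequently the evaluation
  of \<open>G\<close> at all functions \<open>G \<Rightarrow> \<real>\<close> becomes an injective homomorphism once functions are identified
  that agree at every valuation satisfying some countable set of homomorphism conditions.\<close>

section \<open>The variety and its axioms in usable form\<close>

locale sgu_variety =
  fixes G :: "('a, 'b) sgu_scheme"
  assumes in_V: "in_V G"
begin

abbreviation C :: "'a set" where "C \<equiv> sg_carrier G"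
abbreviation zero :: 'a ("\<zero>") where "\<zero> \<equiv> sg_zero G"
abbreviation one :: 'a ("\<one>") where "\<one> \<equiv> sg_one G"
abbreviation add (infixl "\<oplus>" 65) where "x \<oplus> y \<equiv> sg_add G x y"
abbreviation neg ("\<ominus> _" [81] 80) where "\<ominus> x \<equiv> sg_neg G x"
abbreviation join (infixl "\<squnion>" 65) where "x \<squnion> y \<equiv> sg_join G x y"
abbreviation meet (infixl "\<sqinter>" 70) where "x \<sqinter> y \<equiv> sg_meet G x y"
abbreviation le (infix "\<preceq>" 50) where "x \<preceq> y \<equiv> sg_le G x y"

fun mul :: "nat \<Rightarrow> 'a \<Rightarrow> 'a" where
  "mul 0 x = \<zero>"
| "mul (Suc n) x = mul n x \<oplus> x"

lemma closed [simp, intro]: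
  "\<zero> \<in> C" "\<one> \<in> C"
  "x \<in> C \<Longrightarrow> y \<in> C \<Longrightarrow> x \<oplus> y \<in> C"
  "x \<in> C \<Longrightarrow> y \<in> C \<Longrightarrow> x \<squnion> y \<in> C"
  "x \<in> C \<Longrightarrow> y \<in> C \<Longrightarrow> x \<sqinter> y \<in> C"
  "x \<in> C \<Longrightarrow> \<ominus> x \<in> C"
  "x \<in> C \<Longrightarrow> range f \<subseteq> C \<Longrightarrow> sg_bjoin G x f \<in> C"
  using in_V by (simp_all add: in_V_def sg_closed_def)

lemma mul_closed [simp, intro]: "x \<in> C \<Longrightarrow> mul n x \<in> C"
  by (induction n) auto

lemma add_assoc: "x \<in> C \<Longrightarrow> y \<in> C \<Longrightarrow> z \<in> C \<Longrightarrow> (x \<oplus> y) \<oplus> z = x \<oplus> (y \<oplus> z)"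
  and add_comm: "x \<in> C \<Longrightarrow> y \<in> C \<Longrightarrow> x \<oplus> y = y \<oplus> x"
  and add_zero [simp]: "x \<in> C \<Longrightarrow> x \<oplus> \<zero> = x"
  and add_neg [simp]: "x \<in> C \<Longrightarrow> x \<oplus> \<ominus> x = \<zero>"
  and join_assoc: "x \<in> C \<Longrightarrow> y \<in> C \<Longrightarrow> z \<in> C \<Longrightarrow> (x \<squnion> y) \<squnion> z = x \<squnion> (y \<squnion> z)"
  and meet_assoc: "x \<in> C \<Longrightarrow> y \<in> C \<Longrightarrow> z \<in> C \<Longrightarrow> (x \<sqinter> y) \<sqinter> z = x \<sqinter> (y \<sqinter> z)"
  and join_comm: "x \<in> C \<Longrightarrow> y \<in> C \<Longrightarrow> x \<squnion> y = y \<squnion> x"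
  and meet_comm: "x \<in> C \<Longrightarrow> y \<in> C \<Longrightarrow> x \<sqinter> y = y \<sqinter> x"
  and join_meet: "x \<in> C \<Longrightarrow> y \<in> C \<Longrightarrow> x \<squnion> (x \<sqinter> y) = x"
  and meet_join: "x \<in> C \<Longrightarrow> y \<in> C \<Longrightarrow> x \<sqinter> (x \<squnion> y) = x"
  and add_meet: "x \<in> C \<Longrightarrow> y \<in> C \<Longrightarrow> z \<in> C \<Longrightarrow> x \<oplus> (y \<sqinter> z) = (x \<oplus> y) \<sqinter> (x \<oplus> z)"
  using in_V unfolding in_V_def Let_def by (elim conjE, metis)+

lemma bjoin_meet: "g \<in> C \<Longrightarrow> range f \<subseteq> C \<Longrightarrow> sg_bjoin G g f = sg_bjoin G g (\<lambda>n. f n \<sqinter> g)"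
  and bjoin_unfold: "g \<in> C \<Longrightarrow> range f \<subseteq> C \<Longrightarrow>
    sg_bjoin G g f = (f 0 \<sqinter> g) \<squnion> sg_bjoin G g (\<lambda>n. f (Suc n))"
  and bjoin_meet_le: "g \<in> C \<Longrightarrow> h \<in> C \<Longrightarrow> range f \<subseteq> C \<Longrightarrow> sg_bjoin G g (\<lambda>n. f n \<sqinter> h) \<preceq> h"
  and bjoin_one: "x \<in> C \<Longrightarrow>
    sg_bjoin G (sg_abs G x) (\<lambda>n. sg_abs G x \<sqinter> sg_nat G (Suc n)) = sg_abs G x"
  using in_V unfolding in_V_def Let_def by (elim conjE, metis)+

subsection \<open>Abelian lattice-ordered group\<close>

lemma zero_add [simp]: "x \<in> C \<Longrightarrow> \<zero> \<oplus> x = x"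
  using add_comm[of \<zero> x] by simp

lemma neg_add [simp]: "x \<in> C \<Longrightarrow> \<ominus> x \<oplus> x = \<zero>"
  using add_comm[of "\<ominus> x" x] by simp

lemma add_left_comm: "x \<in> C \<Longrightarrow> y \<in> C \<Longrightarrow> z \<in> C \<Longrightarrow> x \<oplus> (y \<oplus> z) = y \<oplus> (x \<oplus> z)"
  by (metis add_assoc add_comm)

lemmas add_ac = add_assoc add_comm add_left_comm

lemma add_neg_cancel [simp]:
  assumes "x \<in> C" "y \<in> C"
  shows "x \<oplus> (\<ominus> x \<oplus> y) = y" "\<ominus> x \<oplus> (x \<oplus> y) = y"
  using assms by (simp_all add: add_assoc[symmetric])

lemma add_diff_cancel: "x \<in> C \<Longrightarrow> y \<in> C \<Longrightarrow> (x \<oplus> y) \<oplus> \<ominus> x = y"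
  by (simp add: add_comm[of x y] add_assoc)

lemma neg_unique: "x \<in> C \<Longrightarrow> y \<in> C \<Longrightarrow> x \<oplus> y = \<zero> \<Longrightarrow> \<ominus> x = y"
  by (metis add_neg_cancel(2) add_zero closed(6))

lemma neg_neg [simp]: "x \<in> C \<Longrightarrow> \<ominus> (\<ominus> x) = x"
  by (rule neg_unique) auto

lemma neg_zero [simp]: "\<ominus> \<zero> = \<zero>"
  by (rule neg_unique) auto

lemma neg_sum: "x \<in> C \<Longrightarrow> y \<in> C \<Longrightarrow> \<ominus> (x \<oplus> y) = \<ominus> x \<oplus> \<ominus> y"
  by (rule neg_unique) (simp_all add: add_ac)

lemma mul_add: "x \<in> C \<Longrightarrow> mul (m + n) x = mul m x \<oplus> mul n x"
  by (induction n) (simp_all add: add_ac)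

lemma mul_mult: "x \<in> C \<Longrightarrow> mul (m * n) x = mul m (mul n x)"
  by (induction m) (simp_all add: mul_add add_ac)

lemma mul_sum: "x \<in> C \<Longrightarrow> y \<in> C \<Longrightarrow> mul n (x \<oplus> y) = mul n x \<oplus> mul n y"
  by (induction n) (simp_all add: add_ac)

lemma mul_one_eq: "mul n \<one> = sg_nat G n"
  by (induction n) auto

lemma le_refl [simp]: "x \<in> C \<Longrightarrow> x \<preceq> x"
  unfolding sg_le_def by (metis closed(5) join_meet meet_join)

lemma le_trans: "x \<preceq> y \<Longrightarrow> y \<preceq> z \<Longrightarrow> x \<in> C \<Longrightarrow> y \<in> C \<Longrightarrow> z \<in> C \<Longrightarrow> x \<preceq> z"
  unfolding sg_le_def by (metis meet_assoc)

lemma le_antisym: "x \<preceq> y \<Longrightarrow> y \<preceq> x \<Longrightarrow> x \<in> C \<Longrightarrow> y \<in> C \<Longrightarrow> x = y"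
  unfolding sg_le_def by (metis meet_comm)

lemma meet_le [simp]:
  assumes "x \<in> C" "y \<in> C"
  shows "x \<sqinter> y \<preceq> x" "x \<sqinter> y \<preceq> y"
  using assms unfolding sg_le_def
  by (metis closed(5) le_refl meet_assoc meet_comm sg_le_def)+

lemma le_meet: "z \<preceq> x \<Longrightarrow> z \<preceq> y \<Longrightarrow> x \<in> C \<Longrightarrow> y \<in> C \<Longrightarrow> z \<in> C \<Longrightarrow> z \<preceq> x \<sqinter> y"
  unfolding sg_le_def by (metis meet_assoc)

lemma le_iff_join: "x \<in> C \<Longrightarrow> y \<in> C \<Longrightarrow> x \<preceq> y \<longleftrightarrow> x \<squnion> y = y"
  unfolding sg_le_def by (metis join_comm join_meet meet_comm meet_join)

lemma le_join [simp]:
  assumes "x \<in> C" "y \<in> C"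
  shows "x \<preceq> x \<squnion> y" "y \<preceq> x \<squnion> y"
  using assms by (simp_all add: sg_le_def meet_join) (metis join_comm meet_join)

lemma join_le: "x \<preceq> z \<Longrightarrow> y \<preceq> z \<Longrightarrow> x \<in> C \<Longrightarrow> y \<in> C \<Longrightarrow> z \<in> C \<Longrightarrow> x \<squnion> y \<preceq> z"
  by (simp add: le_iff_join join_assoc)

lemma add_left_mono: "x \<preceq> y \<Longrightarrow> x \<in> C \<Longrightarrow> y \<in> C \<Longrightarrow> z \<in> C \<Longrightarrow> z \<oplus> x \<preceq> z \<oplus> y"
  unfolding sg_le_def by (metis add_meet)

lemma add_mono:
  assumes "x \<preceq> y" "z \<preceq> w" "x \<in> C" "y \<in> C" "z \<in> C" "w \<in> C"
  shows "x \<oplus> z \<preceq> y \<oplus> w"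
  using add_left_mono[of z w x] add_left_mono[of x y w] assms
  by (metis add_comm closed(3) le_trans)

lemma diff_le_iff:
  assumes "x \<in> C" "y \<in> C" "z \<in> C"
  shows "x \<oplus> \<ominus> y \<preceq> z \<longleftrightarrow> x \<preceq> z \<oplus> y"
proof
  assume "x \<oplus> \<ominus> y \<preceq> z"
  from add_left_mono[OF this, of y] assms show "x \<preceq> z \<oplus> y" by (simp add: add_ac)
next
  assume "x \<preceq> z \<oplus> y"
  from add_left_mono[OF this, of "\<ominus> y"] assms show "x \<oplus> \<ominus> y \<preceq> z"
    by (simp add: add_comm[of z y] add_comm[of x])
qed

lemma le_diff_iff:
  assumes "x \<in> C" "y \<in> C" "z \<in> C"
  shows "x \<preceq> z \<oplus> \<ominus> y \<longleftrightarrow> x \<oplus> y \<preceq> z"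
  using diff_le_iff[of x "\<ominus> y" z] assms by simp

lemma diff_le_zero_iff: "x \<in> C \<Longrightarrow> y \<in> C \<Longrightarrow> x \<oplus> \<ominus> y \<preceq> \<zero> \<longleftrightarrow> x \<preceq> y"
  by (simp add: diff_le_iff)

lemma neg_le_neg:
  assumes "x \<preceq> y" "x \<in> C" "y \<in> C"
  shows "\<ominus> y \<preceq> \<ominus> x"
  using diff_le_iff[of x y \<zero>] le_diff_iff[of "\<ominus> y" x \<zero>] assms
  by (simp add: add_comm)

lemma neg_le_zero: "\<zero> \<preceq> x \<Longrightarrow> x \<in> C \<Longrightarrow> \<ominus> x \<preceq> \<zero>"
  using neg_le_neg[of \<zero> x] by simp

lemma diff_le_self: "\<zero> \<preceq> y \<Longrightarrow> x \<in> C \<Longrightarrow> y \<in> C \<Longrightarrow> x \<oplus> \<ominus> y \<preceq> x"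
  using add_left_mono[of "\<ominus> y" \<zero> x] neg_le_zero[of y] by simp

lemma mul_mono: "x \<preceq> y \<Longrightarrow> x \<in> C \<Longrightarrow> y \<in> C \<Longrightarrow> mul n x \<preceq> mul n y"
  by (induction n) (auto intro: add_mono)

text \<open>Write \<open>p\<close>, \<open>q\<close> for the positive and negative parts and
  \<open>z\<close> for their meet. From \<open>z \<preceq> p \<preceq> x \<oplus> q\<close> it
  follows that both \<open>\<ominus> x\<close> and \<open>\<zero>\<close> lie below
  \<open>q - z\<close>. So \<open>q\<close> lies below \<open>q - z\<close> too, and cancelling
  \<open>q\<close> leaves \<open>z \<preceq> \<zero>\<close>.\<close>

lemma pos_meet_neg:
  assumes x: "x \<in> C"
  shows "(x \<squnion> \<zero>) \<sqinter> (\<ominus> x \<squnion> \<zero>) \<preceq> \<zero>"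
proof -
  let ?p = "x \<squnion> \<zero>" and ?q = "\<ominus> x \<squnion> \<zero>"
  let ?z = "?p \<sqinter> ?q" and ?w = "\<ominus> (?p \<sqinter> ?q) \<oplus> ?q"
  have "?p \<preceq> x \<oplus> ?q"
  proof (rule join_le)
    show "x \<preceq> x \<oplus> ?q" using add_left_mono[of \<zero> ?q x] x by simp
    show "\<zero> \<preceq> x \<oplus> ?q" using add_left_mono[of "\<ominus> x" ?q x] x by simp
  qed (use x in auto)
  then have zx: "?z \<preceq> x \<oplus> ?q" using x le_trans[of ?z ?p "x \<oplus> ?q"] by simp
  have "\<ominus> x \<preceq> ?w"
    using neg_le_neg[OF zx] add_left_mono[of "\<ominus> (x \<oplus> ?q)" "\<ominus> ?z" ?q] x
    by (simp add: neg_sum add_ac)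
  moreover have "\<zero> \<preceq> ?w"
    using add_left_mono[of "?z" ?q "\<ominus> ?z"] x by simp
  ultimately have "?q \<preceq> ?w" using x by (intro join_le) auto
  then show ?thesis
    using add_left_mono[of ?q ?w "?z \<oplus> \<ominus> ?q"] x by (simp add: add_ac)
qed

subsection \<open>Countable suprema and the weak unit\<close>

text \<open>Each use of (A2) exposes the first term and leaves the shifted sequence, so induction on
  the index reaches every term.\<close>

lemma le_bjoin: "g \<in> C \<Longrightarrow> range f \<subseteq> C \<Longrightarrow> f n \<sqinter> g \<preceq> sg_bjoin G g f"
proof (induction n arbitrary: f)
  case 0
  then have "f 0 \<in> C" "range (\<lambda>n. f (Suc n)) \<subseteq> C" by auto
  then show ?case using 0 by (subst bjoin_unfold) auto
next
  case (Suc n)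
  let ?f = "\<lambda>n. f (Suc n)"
  from Suc.prems have f: "f 0 \<in> C" "f (Suc n) \<in> C" "range ?f \<subseteq> C" by auto
  have "?f n \<sqinter> g \<preceq> sg_bjoin G g ?f" using Suc f by blast
  moreover have "sg_bjoin G g ?f \<preceq> sg_bjoin G g f"
    using Suc.prems f by (subst (2) bjoin_unfold) auto
  ultimately show ?case using le_trans Suc.prems f by (meson closed)
qed

text \<open>By (A1) the terms may be taken already truncated at \<open>g\<close>. A further
  truncation at the upper bound \<open>h\<close> changes nothing and brings them into the form
  required by (A3). Together with \<open>le_bjoin\<close>, this makes \<open>sg_bjoin G g f\<close>
  the least upper bound of the truncated terms.\<close>

lemma bjoin_le:
  assumes "g \<in> C" "range f \<subseteq> C" "h \<in> C" "\<And>n. f n \<sqinter> g \<preceq> h"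
  shows "sg_bjoin G g f \<preceq> h"
proof -
  have "range (\<lambda>n. f n \<sqinter> g) \<subseteq> C" using assms by auto
  then have "sg_bjoin G g (\<lambda>n. (f n \<sqinter> g) \<sqinter> h) \<preceq> h" using assms by (intro bjoin_meet_le) auto
  moreover have "(\<lambda>n. (f n \<sqinter> g) \<sqinter> h) = (\<lambda>n. f n \<sqinter> g)" using assms(4) by (simp add: sg_le_def)
  ultimately show ?thesis using bjoin_meet assms by simp
qed

text \<open>Let \<open>s\<close> be the supremum of the multiples of \<open>e\<close>, which exists
  because \<open>u\<close> bounds them. The multiple with factor \<open>n + 1\<close> is also below
  \<open>s\<close>, so \<open>s - e\<close> is again an upper bound. Hence
  \<open>s \<preceq> s - e\<close>.\<close>

lemma archimedean:
  assumes "e \<in> C" "u \<in> C" "\<And>m. mul m e \<preceq> u"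
  shows "e \<preceq> \<zero>"
proof -
  let ?s = "sg_bjoin G u (\<lambda>m. mul m e)"
  have r: "range (\<lambda>m. mul m e) \<subseteq> C" using assms by auto
  have s: "?s \<in> C" using assms r by auto
  have eq: "mul m e \<sqinter> u = mul m e" for m using assms by (simp add: sg_le_def)
  have ub: "mul m e \<preceq> ?s" for m using le_bjoin[of u "\<lambda>m. mul m e" m] assms r eq by simp
  have "?s \<preceq> ?s \<oplus> \<ominus> e"
  proof (rule bjoin_le)
    show "mul n e \<sqinter> u \<preceq> ?s \<oplus> \<ominus> e" for n
      using ub[of "Suc n"] eq s assms by (simp add: le_diff_iff)
  qed (use assms r s in auto)
  then show ?thesis using add_left_mono[of "?s" "?s \<oplus> \<ominus> e" "\<ominus> ?s \<oplus> e"] s assms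
    by (simp add: add_ac)
qed

text \<open>Subtract \<open>y\<close> from the meet \<open>z\<close> of \<open>c\<close> and
  \<open>x \<oplus> y\<close>: the difference lies below \<open>c\<close> because \<open>y\<close>
  is nonnegative, and below \<open>x\<close>, hence below zero. So \<open>z\<close> lies below both
  \<open>y\<close> and \<open>c\<close>.\<close>

lemma disjoint_add:
  assumes "c \<sqinter> x \<preceq> \<zero>" "c \<sqinter> y \<preceq> \<zero>" "\<zero> \<preceq> y" "c \<in> C" "x \<in> C" "y \<in> C"
  shows "c \<sqinter> (x \<oplus> y) \<preceq> \<zero>"
proof -
  let ?z = "c \<sqinter> (x \<oplus> y)"
  have "?z \<oplus> \<ominus> y \<preceq> c"
    using assms diff_le_self[of y ?z] meet_le(1)[of c "x \<oplus> y"]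
      le_trans[of "?z \<oplus> \<ominus> y" ?z c] by simp
  moreover have "?z \<oplus> \<ominus> y \<preceq> x" using assms by (simp add: diff_le_iff)
  ultimately have "?z \<oplus> \<ominus> y \<preceq> c \<sqinter> x" using assms by (intro le_meet) auto
  then have "?z \<oplus> \<ominus> y \<preceq> \<zero>" using assms le_trans[of "?z \<oplus> \<ominus> y" "c \<sqinter> x" \<zero>] by simp
  then have "?z \<preceq> y" using assms by (simp add: diff_le_iff)
  then have "?z \<preceq> c \<sqinter> y" using assms by (intro le_meet) auto
  then show ?thesis using assms le_trans[of ?z "c \<sqinter> y" \<zero>] by simp
qed

section \<open>Signs of elements on a positive element\<close>

text \<open>Thinking of elements as functions, \<open>nonpos c x\<close> says that \<open>x\<close> is nonpositive wherever
  \<open>c\<close> is positive, that is \<open>c\<close> is disjoint from the positive part of \<open>x\<close>.\<close>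

definition nonpos :: "'a \<Rightarrow> 'a \<Rightarrow> bool" where
  "nonpos c x \<longleftrightarrow> (\<exists>y\<in>C. \<zero> \<preceq> y \<and> x \<preceq> y \<and> c \<sqinter> y \<preceq> \<zero>)"

text \<open>These are the conditions in the sense of forcing; a smaller element is a stronger
  condition.\<close>

definition cond :: "'a \<Rightarrow> bool" where
  "cond c \<longleftrightarrow> c \<in> C \<and> \<zero> \<preceq> c \<and> \<not> c \<preceq> \<zero>"

lemma cond_closed [simp]: "cond c \<Longrightarrow> c \<in> C"
  by (simp add: cond_def)

text \<open>The two majorants add up to a majorant by \<open>disjoint_add\<close>. The positive part
  of a sum need not be the sum of the positive parts, so it is convenient that any majorant is
  allowed.\<close>

lemma nonpos_add:
  assumes "nonpos c x" "nonpos c y" "c \<in> C" "x \<in> C" "y \<in> C"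
  shows "nonpos c (x \<oplus> y)"
proof -
  from assms obtain v w where vw: "v \<in> C" "\<zero> \<preceq> v" "x \<preceq> v" "c \<sqinter> v \<preceq> \<zero>"
    "w \<in> C" "\<zero> \<preceq> w" "y \<preceq> w" "c \<sqinter> w \<preceq> \<zero>" unfolding nonpos_def by blast
  show ?thesis unfolding nonpos_def
  proof (intro bexI[of _ "v \<oplus> w"] conjI)
    show "\<zero> \<preceq> v \<oplus> w" using add_mono[of \<zero> v \<zero> w] vw by simp
  qed (use vw assms add_mono disjoint_add in auto)
qed

lemma nonpos_le: "nonpos c x \<Longrightarrow> y \<preceq> x \<Longrightarrow> x \<in> C \<Longrightarrow> y \<in> C \<Longrightarrow> nonpos c y"
  unfolding nonpos_def using le_trans by blast

lemma nonpos_cond_mono: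
  assumes "nonpos c x" "c' \<preceq> c" "c \<in> C" "c' \<in> C"
  shows "nonpos c' x"
proof -
  from assms(1) obtain y where y: "y \<in> C" "\<zero> \<preceq> y" "x \<preceq> y" "c \<sqinter> y \<preceq> \<zero>" unfolding nonpos_def by blast
  have "c' \<sqinter> y \<preceq> c" using le_trans[of "c' \<sqinter> y" c' c] y assms by simp
  then have "c' \<sqinter> y \<preceq> c \<sqinter> y" using y assms by (intro le_meet) auto
  then have "c' \<sqinter> y \<preceq> \<zero>" using y assms le_trans[of "c' \<sqinter> y" "c \<sqinter> y" \<zero>] by simp
  then show ?thesis using y unfolding nonpos_def by blast
qed

lemma nonpos_of_le_zero: "x \<preceq> \<zero> \<Longrightarrow> x \<in> C \<Longrightarrow> c \<in> C \<Longrightarrow> nonpos c x"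
  unfolding nonpos_def by (intro bexI[of _ \<zero>]) auto

lemma nonpos_mul: "nonpos c x \<Longrightarrow> c \<in> C \<Longrightarrow> x \<in> C \<Longrightarrow> nonpos c (mul n x)"
  by (induction n) (auto intro: nonpos_add nonpos_of_le_zero)

lemma nonpos_imp_meet_le:
  assumes "nonpos c x" "c \<in> C" "x \<in> C"
  shows "c \<sqinter> x \<preceq> \<zero>"
proof -
  from assms(1) obtain y where y: "y \<in> C" "\<zero> \<preceq> y" "x \<preceq> y" "c \<sqinter> y \<preceq> \<zero>" unfolding nonpos_def by blast
  have "c \<sqinter> x \<preceq> y" using le_trans[of "c \<sqinter> x" x y] y assms by simp
  then have "c \<sqinter> x \<preceq> c \<sqinter> y" using y assms by (intro le_meet) auto
  then show ?thesis using y assms le_trans[of "c \<sqinter> x" "c \<sqinter> y" \<zero>] by simp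
qed

text \<open>Where \<open>e\<close> is positive, \<open>y\<close> is nonpositive by assumption;
  elsewhere the bound by a multiple of \<open>e\<close> gives the same. Formally, a majorant
  \<open>w\<close> of \<open>y\<close> disjoint from \<open>e\<close> is disjoint from
  \<open>mul m e\<close>, and \<open>y\<close> lies below both. This turns local sign information
  into a global inequality.\<close>

lemma nonpos_imp_le_zero:
  assumes "nonpos e y" "y \<preceq> mul m e" "\<zero> \<preceq> e" "e \<in> C" "y \<in> C"
  shows "y \<preceq> \<zero>"
proof -
  from assms(1) obtain w where w: "w \<in> C" "\<zero> \<preceq> w" "y \<preceq> w" "e \<sqinter> w \<preceq> \<zero>" unfolding nonpos_def by blast
  have "nonpos w e" unfolding nonpos_def using w assms by (metis le_refl meet_comm)
  then have "w \<sqinter> mul m e \<preceq> \<zero>"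
    using w assms by (intro nonpos_imp_meet_le nonpos_mul) auto
  moreover have "y \<preceq> w \<sqinter> mul m e" using w assms by (intro le_meet) auto
  ultimately show ?thesis using w assms le_trans[of y "w \<sqinter> mul m e" \<zero>] by simp
qed

text \<open>Here \<open>\<one>\<close> is shown to be a weak unit. If \<open>c\<close> were disjoint
  from it, then \<open>c\<close> would be disjoint from all its multiples, while the last axiom
  presents \<open>c\<close> as the supremum of its meets with these multiples.\<close>

lemma not_nonpos_one:
  assumes c: "cond c"
  shows "\<not> nonpos c \<one>"
proof
  assume n: "nonpos c \<one>"
  from c have C: "c \<in> C" "\<zero> \<preceq> c" by (auto simp: cond_def)
  have "\<ominus> c \<preceq> c" using neg_le_zero[of c] C le_trans[of "\<ominus> c" \<zero> c] by simp
  then have abs: "sg_abs G c = c" using C le_iff_join[of "\<ominus> c" c]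
    by (simp add: sg_abs_def join_comm)
  have "sg_bjoin G c (\<lambda>n. c \<sqinter> mul (Suc n) \<one>) \<preceq> \<zero>"
  proof (rule bjoin_le)
    fix k
    have m: "mul (Suc k) \<one> \<in> C" by (rule mul_closed) simp
    have "c \<sqinter> mul (Suc k) \<one> \<preceq> \<zero>"
      using C n by (intro nonpos_imp_meet_le nonpos_mul) auto
    then show "(c \<sqinter> mul (Suc k) \<one>) \<sqinter> c \<preceq> \<zero>"
      using C m le_trans[of "(c \<sqinter> mul (Suc k) \<one>) \<sqinter> c" "c \<sqinter> mul (Suc k) \<one>" \<zero>] by (meson closed meet_le)
  qed (use C in \<open>auto simp del: mul.simps\<close>)
  moreover have "sg_bjoin G c (\<lambda>n. c \<sqinter> mul (Suc n) \<one>) = c"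
    using bjoin_one[OF C(1)] abs by (simp add: mul_one_eq del: mul.simps sg_nat.simps)
  ultimately show False using c by (simp add: cond_def)
qed

text \<open>On its negative part \<open>\<one>\<close> is nonpositive, so that negative part cannot
  be a condition and must vanish.\<close>

lemma one_nonneg: "\<zero> \<preceq> \<one>"
proof -
  let ?c = "\<ominus> \<one> \<squnion> \<zero>"
  have "nonpos ?c \<one>" unfolding nonpos_def
    using pos_meet_neg[of \<one>] by (intro bexI[of _ "\<one> \<squnion> \<zero>"]) (auto simp: meet_comm)
  then have "\<not> cond ?c" using not_nonpos_one by blast
  then have "?c \<preceq> \<zero>" unfolding cond_def by simp
  then have "\<ominus> \<one> \<preceq> \<zero>" using le_trans[of "\<ominus> \<one>" ?c \<zero>] by simp
  then show ?thesis using neg_le_neg[of "\<ominus> \<one>" \<zero>] by simp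
qed

subsection \<open>Generic chains of positive elements\<close>

text \<open>Either \<open>c\<close> is disjoint from the positive part of \<open>x\<close>, or their
  meet is a smaller condition on which \<open>x\<close> is positive; it is disjoint from the
  negative part by \<open>pos_meet_neg\<close>.\<close>

lemma decide:
  assumes c: "cond c" and x: "x \<in> C"
  shows "nonpos c x \<or> (\<exists>c'. cond c' \<and> c' \<preceq> c \<and> nonpos c' (\<ominus> x))"
proof (cases "c \<sqinter> (x \<squnion> \<zero>) \<preceq> \<zero>")
  case True
  then have "nonpos c x" unfolding nonpos_def using x by (intro bexI[of _ "x \<squnion> \<zero>"]) auto
  then show ?thesis ..
next
  case False
  let ?p = "x \<squnion> \<zero>" and ?q = "\<ominus> x \<squnion> \<zero>"
  let ?c = "c \<sqinter> ?p"
  have C: "c \<in> C" "\<zero> \<preceq> c" using c by (auto simp: cond_def)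
  have "\<zero> \<preceq> ?c" using C x by (intro le_meet) auto
  then have "cond ?c" using False C x by (simp add: cond_def)
  moreover have "nonpos ?c (\<ominus> x)"
  proof -
    have "?c \<sqinter> ?q \<preceq> ?p" using le_trans[of "?c \<sqinter> ?q" ?c ?p] C x by simp
    then have "?c \<sqinter> ?q \<preceq> ?p \<sqinter> ?q" using C x by (intro le_meet) auto
    then have "?c \<sqinter> ?q \<preceq> \<zero>"
      using le_trans[of "?c \<sqinter> ?q" "?p \<sqinter> ?q" \<zero>] pos_meet_neg[OF x] C x by simp
    then show ?thesis unfolding nonpos_def using x by (intro bexI[of _ ?q]) auto
  qed
  moreover have "?c \<preceq> c" using C x by simp
  ultimately show ?thesis by blast
qed

lemma cond_meet_one: "cond c \<Longrightarrow> cond (c \<sqinter> \<one>)"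
proof -
  assume c: "cond c"
  then have C: "c \<in> C" "\<zero> \<preceq> c" by (auto simp: cond_def)
  have "\<not> c \<sqinter> \<one> \<preceq> \<zero>"
    using not_nonpos_one[OF c] one_nonneg unfolding nonpos_def by (metis closed(2) le_refl)
  then show ?thesis using C one_nonneg by (simp add: cond_def le_meet)
qed

lemma cond_mul_unbounded:
  assumes c: "cond c" and u: "u \<in> C"
  shows "\<exists>n. \<not> mul n c \<preceq> u"
  using archimedean[OF cond_closed[OF c] u] c unfolding cond_def by blast

lemma dense_total:
  assumes "cond c" "x \<in> C"
  shows "\<exists>c'. cond c' \<and> c' \<preceq> c \<and> (nonpos c' x \<or> nonpos c' (\<ominus> x))"
proof (cases "nonpos c x")
  case True
  then show ?thesis using assms(1) by (intro exI[of _ c]) simp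
next
  case False
  then show ?thesis using decide[OF assms] by blast
qed

text \<open>If no smaller condition bounds \<open>x\<close>, then \<open>decide\<close> gives
  \<open>x\<close> at least \<open>mul n \<one>\<close> on \<open>c\<close> for every
  \<open>n\<close>. Capping \<open>c\<close> at \<open>\<one>\<close> makes the multiples of
  \<open>?e\<close> comparable with those of \<open>\<one>\<close>, so the positive part of
  \<open>x\<close> bounds all of them, against the Archimedean property.\<close>

lemma dense_bounded:
  assumes c: "cond c" and x: "x \<in> C"
  shows "\<exists>c'. cond c' \<and> c' \<preceq> c \<and> (\<exists>n. nonpos c' (x \<oplus> \<ominus> mul n \<one>))"
proof (rule ccontr)
  assume neg: "\<not> ?thesis"
  let ?e = "c \<sqinter> \<one>" and ?p = "x \<squnion> \<zero>"
  have C: "c \<in> C" using c by simp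
  have e: "cond ?e" using cond_meet_one[OF c] .
  have "mul n ?e \<preceq> ?p" for n
  proof -
    have "\<ominus> (mul n \<one> \<oplus> \<ominus> x) = x \<oplus> \<ominus> mul n \<one>" using x by (simp add: neg_sum add_comm)
    then have "nonpos c (mul n \<one> \<oplus> \<ominus> x)"
      using decide[OF c, of "mul n \<one> \<oplus> \<ominus> x"] neg x by auto
    then have 1: "nonpos ?e (mul n \<one> \<oplus> \<ominus> x)" using nonpos_cond_mono C by auto
    have "mul n ?e \<oplus> \<ominus> ?p \<preceq> mul n \<one> \<oplus> \<ominus> x"
      using x C by (intro add_mono mul_mono neg_le_neg) auto
    then have 2: "nonpos ?e (mul n ?e \<oplus> \<ominus> ?p)" using nonpos_le[OF 1] x C by auto
    have "mul n ?e \<oplus> \<ominus> ?p \<preceq> mul n ?e" using x C by (intro diff_le_self) auto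
    then have "mul n ?e \<oplus> \<ominus> ?p \<preceq> \<zero>"
      using nonpos_imp_le_zero[OF 2] e x C unfolding cond_def by blast
    then show ?thesis using x C by (simp add: diff_le_zero_iff)
  qed
  then show False using cond_mul_unbounded[OF e, of ?p] x by auto
qed

text \<open>Some multiple of \<open>c\<close> exceeds \<open>\<one>\<close> on a smaller condition,
  since otherwise \<open>\<one>\<close> would bound all multiples of \<open>c\<close>. This later
  keeps the real value of a given element strictly positive.\<close>

lemma dense_large:
  assumes c: "cond c"
  shows "\<exists>c'. cond c' \<and> c' \<preceq> c \<and> (\<exists>m. nonpos c' (\<one> \<oplus> \<ominus> mul m c))"
proof (rule ccontr)
  assume neg: "\<not> ?thesis"
  have C: "c \<in> C" using c by simp
  have "mul m c \<preceq> \<one>" for m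
  proof -
    have "\<ominus> (mul m c \<oplus> \<ominus> \<one>) = \<one> \<oplus> \<ominus> mul m c" using C by (simp add: neg_sum add_comm)
    then have 1: "nonpos c (mul m c \<oplus> \<ominus> \<one>)"
      using decide[OF c, of "mul m c \<oplus> \<ominus> \<one>"] neg C by auto
    have "mul m c \<oplus> \<ominus> \<one> \<preceq> mul m c" using C one_nonneg by (intro diff_le_self) auto
    then have "mul m c \<oplus> \<ominus> \<one> \<preceq> \<zero>"
      using nonpos_imp_le_zero[OF 1] c unfolding cond_def by blast
    then show ?thesis using C by (simp add: diff_le_zero_iff)
  qed
  then show False using cond_mul_unbounded[OF c, of \<one>] by auto
qed

section \<open>Families with infimum zero\<close>

definition sum_along :: "(nat \<Rightarrow> 'a) \<Rightarrow> nat list \<Rightarrow> 'a" where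
  "sum_along u ns = foldr (\<lambda>n s. u n \<oplus> s) ns \<zero>"

lemma sum_along_simps [simp]:
  "sum_along u [] = \<zero>" "sum_along u (n # ns) = u n \<oplus> sum_along u ns"
  by (simp_all add: sum_along_def)

lemma sum_along_closed [simp, intro]: "range u \<subseteq> C \<Longrightarrow> sum_along u ns \<in> C"
  by (induction ns) auto

lemma sum_along_nonneg: "range u \<subseteq> C \<Longrightarrow> (\<And>n. \<zero> \<preceq> u n) \<Longrightarrow> \<zero> \<preceq> sum_along u ns"
proof (induction ns)
  case (Cons n ns)
  then show ?case using add_mono[of \<zero> "u n" \<zero> "sum_along u ns"] by auto
qed simp

definition inf_zero :: "(nat \<Rightarrow> 'a) \<Rightarrow> bool" where
  "inf_zero u \<longleftrightarrow> range u \<subseteq> C \<and> (\<forall>n. \<zero> \<preceq> u n) \<and> (\<forall>e\<in>C. (\<forall>n. e \<preceq> u n) \<longrightarrow> e \<preceq> \<zero>)"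

text \<open>Fix the first index \<open>n\<close>: then \<open>e - u n\<close> is a lower bound of
  all sums with one term fewer, so it is at most zero by induction. As \<open>n\<close> was
  arbitrary, \<open>e\<close> is a lower bound of \<open>u\<close> itself.\<close>

lemma inf_zero_sum_along:
  assumes u: "inf_zero u"
  shows "e \<in> C \<Longrightarrow> (\<And>ns. length ns = m \<Longrightarrow> e \<preceq> sum_along u ns) \<Longrightarrow> e \<preceq> \<zero>"
proof (induction m arbitrary: e)
  case 0
  then show ?case by force
next
  case (Suc m)
  have u': "range u \<subseteq> C" using u by (simp add: inf_zero_def)
  have "e \<preceq> u n" for n
  proof -
    have un: "u n \<in> C" using u' by auto
    have "e \<oplus> \<ominus> u n \<preceq> sum_along u ns" if "length ns = m" for ns
      using Suc.prems(2)[of "n # ns"] that un u' Suc.prems(1) by (simp add: diff_le_iff add_comm)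
    then have "e \<oplus> \<ominus> u n \<preceq> \<zero>" using un Suc.prems(1) by (intro Suc.IH) auto
    then show ?thesis using un Suc.prems(1) by (simp add: diff_le_zero_iff)
  qed
  then show ?case using u Suc.prems(1) by (auto simp: inf_zero_def)
qed

text \<open>A single \<open>u n\<close> below \<open>1/m\<close> cannot be expressed in a group; in a totally ordered quotient
  it follows from a sum of \<open>m\<close> terms lying below \<open>1\<close>.\<close>

lemma dense_sup:
  assumes c: "cond c" and u: "inf_zero u"
  shows "\<exists>c'. cond c' \<and> c' \<preceq> c \<and> (\<exists>ns. length ns = m \<and> nonpos c' (sum_along u ns \<oplus> \<ominus> \<one>))"
proof (rule ccontr)
  assume neg: "\<not> ?thesis"
  let ?e = "c \<sqinter> \<one>"
  have C: "c \<in> C" using c by simp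
  have e: "cond ?e" using cond_meet_one[OF c] .
  have u': "range u \<subseteq> C" using u by (simp add: inf_zero_def)
  \<comment> \<open>If no smaller condition works, \<open>decide\<close> makes every such sum at
    least \<open>\<one>\<close> on \<open>c\<close>, and \<open>nonpos_imp_le_zero\<close> turns
    this into a global lower bound \<open>?e\<close> of all sums of \<open>m\<close> terms.\<close>
  have "?e \<preceq> sum_along u ns" if ns: "length ns = m" for ns
  proof -
    let ?s = "sum_along u ns"
    have s: "?s \<in> C" "\<zero> \<preceq> ?s" using u sum_along_nonneg by (auto simp: inf_zero_def)
    have "\<ominus> (\<one> \<oplus> \<ominus> ?s) = ?s \<oplus> \<ominus> \<one>" using s by (simp add: neg_sum add_comm)
    then have "nonpos c (\<one> \<oplus> \<ominus> ?s)" using decide[OF c, of "\<one> \<oplus> \<ominus> ?s"] neg s ns by auto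
    then have 1: "nonpos ?e (\<one> \<oplus> \<ominus> ?s)" using nonpos_cond_mono C by auto
    have "?e \<oplus> \<ominus> ?s \<preceq> \<one> \<oplus> \<ominus> ?s" using s C by (intro add_mono) auto
    then have 2: "nonpos ?e (?e \<oplus> \<ominus> ?s)" using nonpos_le[OF 1] s C by auto
    have "?e \<oplus> \<ominus> ?s \<preceq> mul 1 ?e" using s C by (simp add: diff_le_self)
    then have "?e \<oplus> \<ominus> ?s \<preceq> \<zero>"
      using nonpos_imp_le_zero[OF 2] e s C unfolding cond_def by blast
    then show ?thesis using s C by (simp add: diff_le_zero_iff)
  qed
  then have "?e \<preceq> \<zero>" using inf_zero_sum_along[OF u, of ?e m] C by auto
  then show False using e by (simp add: cond_def)
qed

text \<open>Enumerate the requirements and meet them one after another, each by shrinking the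
  current condition.\<close>

lemma generic_chain:
  assumes "countable Q" "cond c0"
    and dense: "\<And>q c. q \<in> Q \<Longrightarrow> cond c \<Longrightarrow> \<exists>c'. cond c' \<and> c' \<preceq> c \<and> q c'"
  obtains c where "\<And>k. cond (c k)" "\<And>k. c (Suc k) \<preceq> c k" "c 0 = c0"
    "\<And>q. q \<in> Q \<Longrightarrow> \<exists>k. q (c k)"
proof -
  \<comment> \<open>The trivial requirement makes the set nonempty, so that it can be enumerated by
    all natural numbers.\<close>
  let ?Q = "insert (\<lambda>_. True) Q"
  define q where "q = from_nat_into ?Q"
  have q: "q n \<in> ?Q" for n unfolding q_def by (intro from_nat_into) simp
  have step: "\<exists>c'. cond c' \<and> c' \<preceq> c \<and> q n c'" if "cond c" for c n
  proof (cases "q n \<in> Q")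
    case True
    then show ?thesis using that by (rule dense)
  next
    case False
    then have "q n = (\<lambda>_. True)" using q[of n] by blast
    then show ?thesis using that by (intro exI[of _ c]) simp
  qed
  have "\<exists>c. \<forall>n. (cond (c n) \<and> (n = 0 \<longrightarrow> c n = c0)) \<and> (c (Suc n) \<preceq> c n \<and> q n (c (Suc n)))"
  proof (rule dependent_nat_choice)
    show "\<exists>c. cond c \<and> ((0::nat) = 0 \<longrightarrow> c = c0)" using assms(2) by (intro exI[of _ c0]) simp
  next
    fix c and n :: nat
    assume "cond c \<and> (n = 0 \<longrightarrow> c = c0)"
    then show "\<exists>c'. (cond c' \<and> (Suc n = 0 \<longrightarrow> c' = c0)) \<and> c' \<preceq> c \<and> q n c'"
      using step[of c n] by simp
  qed
  then obtain c where "\<forall>n. (cond (c n) \<and> (n = 0 \<longrightarrow> c n = c0)) \<and> (c (Suc n) \<preceq> c n \<and> q n (c (Suc n)))" ..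
  then have c: "c 0 = c0" "\<And>n. cond (c n)" "\<And>n. c (Suc n) \<preceq> c n" "\<And>n. q n (c (Suc n))"
    by simp_all
  have "\<exists>k. p (c k)" if p: "p \<in> Q" for p
  proof -
    have "countable ?Q" using assms(1) by simp
    then obtain n where "q n = p"
      using from_nat_into_surj[of ?Q p, OF _ insertI2[OF p]] unfolding q_def by blast
    then show ?thesis using c(4)[of n] by auto
  qed
  then show thesis by (rule that[OF c(2,3,1)])
qed

end

section \<open>Total cones obtained from generic chains\<close>

text \<open>\<open>N x\<close> reads: \<open>x\<close> is at most zero at the generic point. The
  order properties hold on the whole carrier, whereas totality and boundedness are demanded only on
  \<open>E\<close>; there they amount to countably many requirements when \<open>E\<close> is
  countable.\<close>

locale sgu_cone = sgu_variety G for G :: "('a, 'b) sgu_scheme" +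
  fixes E :: "'a set" and N :: "'a \<Rightarrow> bool"
  assumes E_sub: "E \<subseteq> C"
    and E_zero [simp]: "\<zero> \<in> E" and E_one [simp]: "\<one> \<in> E"
    and E_neg [simp]: "x \<in> E \<Longrightarrow> \<ominus> x \<in> E"
    and E_add [simp]: "x \<in> E \<Longrightarrow> y \<in> E \<Longrightarrow> x \<oplus> y \<in> E"
    and E_join [simp]: "x \<in> E \<Longrightarrow> y \<in> E \<Longrightarrow> x \<squnion> y \<in> E"
    and E_meet [simp]: "x \<in> E \<Longrightarrow> y \<in> E \<Longrightarrow> x \<sqinter> y \<in> E"
    and N_le: "N x \<Longrightarrow> y \<preceq> x \<Longrightarrow> x \<in> C \<Longrightarrow> y \<in> C \<Longrightarrow> N y"
    and N_add: "N x \<Longrightarrow> N y \<Longrightarrow> x \<in> C \<Longrightarrow> y \<in> C \<Longrightarrow> N (x \<oplus> y)"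
    and N_zero: "N \<zero>"
    and N_pos: "N x \<Longrightarrow> x \<in> C \<Longrightarrow> N (x \<squnion> \<zero>)"
    and N_one: "\<not> N \<one>"
    and N_total: "x \<in> E \<Longrightarrow> N x \<or> N (\<ominus> x)"
    and N_bounded: "x \<in> E \<Longrightarrow> \<exists>n. N (x \<oplus> \<ominus> mul n \<one>)"

text \<open>\<open>N\<close> collects the elements that become nonpositive on some member of a
  generic chain. Since the chain decreases, two such facts hold together from some member
  on.\<close>

lemma (in sgu_variety) generic_cone:
  assumes E: "E \<subseteq> C" "countable E" "\<zero> \<in> E" "\<one> \<in> E"
      "\<And>x. x \<in> E \<Longrightarrow> \<ominus> x \<in> E"
      "\<And>x y. x \<in> E \<Longrightarrow> y \<in> E \<Longrightarrow> x \<oplus> y \<in> E \<and> x \<squnion> y \<in> E \<and> x \<sqinter> y \<in> E"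
    and U: "countable U" "\<And>u. u \<in> U \<Longrightarrow> inf_zero u"
    and d: "cond d"
  obtains N where "sgu_cone G E N"
    "\<And>u m. u \<in> U \<Longrightarrow> \<exists>ns. length ns = m \<and> N (sum_along u ns \<oplus> \<ominus> \<one>)"
    "\<exists>m. N (\<one> \<oplus> \<ominus> mul m d)"
proof -
  let ?T = "\<lambda>x c. nonpos c x \<or> nonpos c (\<ominus> x)"
  let ?B = "\<lambda>x c. \<exists>n. nonpos c (x \<oplus> \<ominus> mul n \<one>)"
  let ?S = "\<lambda>(u, m) c. \<exists>ns. length ns = m \<and> nonpos c (sum_along u ns \<oplus> \<ominus> \<one>)"
  let ?Q = "?T ` E \<union> ?B ` E \<union> ?S ` (U \<times> (UNIV :: nat set))"
  \<comment> \<open>The chain starts at a condition on which a multiple of \<open>d\<close> exceeds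
    \<open>\<one>\<close>, which yields the last conclusion.\<close>
  from dense_large[OF d] obtain c0 m where c0: "cond c0" "nonpos c0 (\<one> \<oplus> \<ominus> mul m d)" by blast
  have "countable ?Q" using E U by auto
  moreover have "\<exists>c'. cond c' \<and> c' \<preceq> c \<and> q c'" if "q \<in> ?Q" "cond c" for q c
    using that dense_total[of c] dense_bounded[of c] dense_sup[of c] E(1) U(2)
    by (elim UnE imageE) (auto simp: subset_iff)
  ultimately obtain c where c: "\<And>k. cond (c k)" "\<And>k. c (Suc k) \<preceq> c k" "c 0 = c0"
    and gen: "\<And>q. q \<in> ?Q \<Longrightarrow> \<exists>k. q (c k)"
    using generic_chain[of ?Q c0] c0(1) by blast
  have [simp]: "c k \<in> C" for k using c(1) by simp
  have mono: "c k \<preceq> c j" if "j \<le> k" for j k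
    using that by (induction k rule: dec_induct) (auto intro: le_trans c(2))
  define N where "N x \<longleftrightarrow> (\<exists>k. nonpos (c k) x)" for x
  have N_max: "\<exists>k. nonpos (c k) x \<and> nonpos (c k) y" if xy: "N x" "N y" for x y
  proof -
    from xy obtain i j where "nonpos (c i) x" "nonpos (c j) y" by (auto simp: N_def)
    then have "nonpos (c (max i j)) x" "nonpos (c (max i j)) y"
      using nonpos_cond_mono mono by (meson \<open>\<And>k. c k \<in> C\<close> max.cobounded1 max.cobounded2)+
    then show ?thesis by blast
  qed
  show thesis
  proof (rule that[of N])
    show "sgu_cone G E N"
    proof unfold_locales
      show "N x \<or> N (\<ominus> x)" if "x \<in> E" for x
        using gen[of "?T x"] that by (auto simp: N_def)
      show "\<exists>n. N (x \<oplus> \<ominus> mul n \<one>)" if "x \<in> E" for x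
        using gen[of "?B x"] that by (auto simp: N_def)
      show "N (x \<oplus> y)" if "N x" "N y" "x \<in> C" "y \<in> C" for x y
        using N_max[OF that(1,2)] nonpos_add that(3,4) \<open>\<And>k. c k \<in> C\<close> unfolding N_def by blast
      show "N y" if "N x" "y \<preceq> x" "x \<in> C" "y \<in> C" for x y
        using that nonpos_le by (auto simp: N_def)
      show "N \<zero>" using nonpos_of_le_zero by (auto simp: N_def)
      show "\<not> N \<one>" using not_nonpos_one c(1) by (auto simp: N_def)
      \<comment> \<open>The witness for \<open>x\<close> is nonnegative, so it majorizes the
        positive part as well.\<close>
      show "N (x \<squnion> \<zero>)" if "N x" "x \<in> C" for x
        using that join_le unfolding N_def nonpos_def by (metis closed(1))
    qed (use E in auto)
    show "\<exists>ns. length ns = m \<and> N (sum_along u ns \<oplus> \<ominus> \<one>)" if "u \<in> U" for u m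
      using gen[of "?S (u, m)"] that unfolding N_def by blast
    show "\<exists>m. N (\<one> \<oplus> \<ominus> mul m d)" using c0 c(3) unfolding N_def by metis
  qed
qed

context sgu_cone
begin

subsection \<open>The real-valued character of a total cone\<close>

definition below :: "'a \<Rightarrow> 'a \<Rightarrow> bool" where
  "below x y \<longleftrightarrow> N (x \<oplus> \<ominus> y)"

text \<open>An upper Dedekind cut: the inequality encodes that \<open>x\<close> is at most the
  rational \<open>(a - b) / q\<close>. The integer numerator is split into two naturals because
  \<open>mul\<close> takes only natural multiples.\<close>

definition char :: "'a \<Rightarrow> real" where
  "char x = Inf {(real a - real b) / real q | a b q.
     0 < q \<and> below (mul q x \<oplus> mul b \<one>) (mul a \<one>)}"

lemma E_closed [simp]: "x \<in> E \<Longrightarrow> x \<in> C"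
  using E_sub by blast

lemma E_mul [simp]: "x \<in> E \<Longrightarrow> mul n x \<in> E"
  by (induction n) auto

lemma le_imp_below: "x \<preceq> y \<Longrightarrow> x \<in> C \<Longrightarrow> y \<in> C \<Longrightarrow> below x y"
  using N_le[OF N_zero, of "x \<oplus> \<ominus> y"] by (simp add: below_def diff_le_zero_iff)

lemma below_refl [simp]: "x \<in> C \<Longrightarrow> below x x"
  by (simp add: le_imp_below)

lemma below_trans:
  assumes "below x y" "below y z" "x \<in> C" "y \<in> C" "z \<in> C"
  shows "below x z"
proof -
  have "(x \<oplus> \<ominus> y) \<oplus> (y \<oplus> \<ominus> z) = x \<oplus> \<ominus> z" using assms by (simp add: add_assoc)
  then show ?thesis using N_add[of "x \<oplus> \<ominus> y" "y \<oplus> \<ominus> z"] assms by (simp add: below_def)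
qed

lemma below_add:
  assumes "below x y" "below z w" "x \<in> C" "y \<in> C" "z \<in> C" "w \<in> C"
  shows "below (x \<oplus> z) (y \<oplus> w)"
proof -
  have "(x \<oplus> \<ominus> y) \<oplus> (z \<oplus> \<ominus> w) = (x \<oplus> z) \<oplus> \<ominus> (y \<oplus> w)"
    using assms by (simp add: neg_sum add_ac)
  then show ?thesis using N_add[of "x \<oplus> \<ominus> y" "z \<oplus> \<ominus> w"] assms by (simp add: below_def)
qed

lemma below_mul: "below x y \<Longrightarrow> x \<in> C \<Longrightarrow> y \<in> C \<Longrightarrow> below (mul n x) (mul n y)"
  by (induction n) (simp_all add: below_add)

lemma below_total:
  assumes "x \<in> E" "y \<in> E"
  shows "below x y \<or> below y x"
proof -
  have "\<ominus> (x \<oplus> \<ominus> y) = y \<oplus> \<ominus> x" using assms by (simp add: neg_sum add_comm)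
  then show ?thesis using N_total[of "x \<oplus> \<ominus> y"] assms by (simp add: below_def)
qed

lemma mul_nonneg: "\<zero> \<preceq> x \<Longrightarrow> x \<in> C \<Longrightarrow> \<zero> \<preceq> mul n x"
proof (induction n)
  case (Suc n)
  then show ?case using add_mono[of \<zero> "mul n x" \<zero> x] by simp
qed simp

text \<open>If \<open>m\<close> exceeded \<open>n\<close>, the difference of the two multiples would
  dominate \<open>\<one>\<close>, which is not in the cone.\<close>

lemma below_one_iff:
  assumes "below (mul m \<one>) (mul n \<one>)"
  shows "m \<le> n"
proof (rule ccontr)
  assume "\<not> m \<le> n"
  then obtain k where m: "m = n + Suc k" by (metis add_Suc_right less_iff_Suc_add not_le)
  have "mul m \<one> = mul n \<one> \<oplus> (mul k \<one> \<oplus> \<one>)" by (simp only: m mul_add closed mul.simps)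
  then have "mul m \<one> \<oplus> \<ominus> mul n \<one> = mul k \<one> \<oplus> \<one>" by (simp add: add_diff_cancel)
  moreover have "\<one> \<preceq> mul k \<one> \<oplus> \<one>"
    using add_mono[of \<zero> "mul k \<one>" \<one> \<one>] mul_nonneg[OF one_nonneg, of k] by simp
  ultimately show False using assms N_one N_le[of "mul k \<one> \<oplus> \<one>" \<one>] by (simp add: below_def)
qed

text \<open>Cross-multiplying by \<open>q\<close> and \<open>q'\<close> gives both inequalities the
  same multiple of \<open>x\<close>; eliminating it leaves a comparison of multiples of
  \<open>\<one>\<close>.\<close>

lemma cuts_le:
  assumes q: "0 < q" "below (mul q x \<oplus> mul b \<one>) (mul a \<one>)"
    and q': "0 < q'" "below (mul a' \<one>) (mul q' x \<oplus> mul b' \<one>)"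
    and x: "x \<in> C"
  shows "(real a' - real b') / real q' \<le> (real a - real b) / real q"
proof -
  have "below (mul q (mul a' \<one>) \<oplus> mul q' (mul b \<one>))
      (mul q (mul q' x \<oplus> mul b' \<one>) \<oplus> mul q' (mul b \<one>))"
    using q' x by (intro below_add below_mul) auto
  moreover have "mul q (mul q' x \<oplus> mul b' \<one>) \<oplus> mul q' (mul b \<one>)
      = mul q' (mul q x \<oplus> mul b \<one>) \<oplus> mul q (mul b' \<one>)"
    using x by (simp add: mul_sum mul_mult[symmetric] add_ac mult.commute)
  moreover have "below (mul q' (mul q x \<oplus> mul b \<one>) \<oplus> mul q (mul b' \<one>))
      (mul q' (mul a \<one>) \<oplus> mul q (mul b' \<one>))"
    using q x by (intro below_add below_mul) auto
  ultimately have "below (mul q (mul a' \<one>) \<oplus> mul q' (mul b \<one>)) (mul q' (mul a \<one>) \<oplus> mul q (mul b' \<one>))"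
    using x below_trans[of "mul q (mul a' \<one>) \<oplus> mul q' (mul b \<one>)"
        "mul q' (mul q x \<oplus> mul b \<one>) \<oplus> mul q (mul b' \<one>)"] by simp
  then have "below (mul (q * a' + q' * b) \<one>) (mul (q' * a + q * b') \<one>)"
    by (simp add: mul_add mul_mult)
  then have "q * a' + q' * b \<le> q' * a + q * b'" by (rule below_one_iff)
  then have "real (q * a' + q' * b) \<le> real (q' * a + q * b')" by (rule of_nat_mono)
  then show ?thesis using q(1) q'(1) by (simp add: field_simps)
qed

lemma char_le:
  assumes x: "x \<in> E" and q: "0 < q" "below (mul q x \<oplus> mul b \<one>) (mul a \<one>)"
  shows "char x \<le> (real a - real b) / real q"
  unfolding char_def
proof (rule cInf_lower)
  obtain n where "N (\<ominus> x \<oplus> \<ominus> mul n \<one>)" using N_bounded[of "\<ominus> x"] x by auto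
  then have n: "below (mul 0 \<one>) (mul 1 x \<oplus> mul n \<one>)" using x by (simp add: below_def neg_sum)
  show "bdd_below {(real a - real b) / real q | a b q.
     0 < q \<and> below (mul q x \<oplus> mul b \<one>) (mul a \<one>)}"
    using cuts_le[OF _ _ _ n] x by (intro bdd_belowI[of _ "(real 0 - real n) / real 1"]) auto
qed (use q in blast)

lemma le_char:
  assumes x: "x \<in> E" and q: "0 < q" "below (mul a \<one>) (mul q x \<oplus> mul b \<one>)"
  shows "(real a - real b) / real q \<le> char x"
  unfolding char_def
proof (rule cInf_greatest)
  obtain n where "N (x \<oplus> \<ominus> mul n \<one>)" using N_bounded[of x] x by auto
  then have "below (mul 1 x \<oplus> mul 0 \<one>) (mul n \<one>)" using x by (simp add: below_def)
  then show "{(real a - real b) / real q | a b q.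
     0 < q \<and> below (mul q x \<oplus> mul b \<one>) (mul a \<one>)} \<noteq> {}"
    using zero_less_one by blast
qed (use q x cuts_le in auto)

text \<open>By totality, failure of the inequality would give the reverse one, and
  \<open>le_char\<close> would contradict the strict bound.\<close>

lemma char_less:
  assumes "x \<in> E" "0 < q" "char x < (real a - real b) / real q"
  shows "below (mul q x \<oplus> mul b \<one>) (mul a \<one>)"
  using le_char[OF assms(1,2), of a b] below_total[of "mul q x \<oplus> mul b \<one>" "mul a \<one>"] assms by auto

lemma less_char:
  assumes "x \<in> E" "0 < q" "(real a - real b) / real q < char x"
  shows "below (mul a \<one>) (mul q x \<oplus> mul b \<one>)"
  using char_le[OF assms(1,2), of b a] below_total[of "mul q x \<oplus> mul b \<one>" "mul a \<one>"] assms by auto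

lemma int_as_nat_diff: "\<exists>a b. real_of_int p = real a - real b"
proof (cases "p \<ge> 0")
  case True
  then show ?thesis by (intro exI[of _ "nat p"] exI[of _ 0]) simp
next
  case False
  then show ?thesis by (intro exI[of _ 0] exI[of _ "nat (- p)"]) simp
qed

lemma approx_above:
  assumes "0 < q"
  obtains a b where "t < (real a - real b) / real q" "(real a - real b) / real q \<le> t + 1 / real q"
proof -
  define p where "p = \<lfloor>real q * t\<rfloor> + 1"
  have "real q * t < real_of_int p" "real_of_int p \<le> real q * t + 1" unfolding p_def by linarith+
  then have "t < real_of_int p / real q" "real_of_int p / real q \<le> t + 1 / real q"
    using assms by (simp_all add: field_simps)
  then show thesis using int_as_nat_diff[of p] that by metis
qed

lemma approx_below:
  assumes "0 < q"
  obtains a b where "(real a - real b) / real q < t" "t - 1 / real q \<le> (real a - real b) / real q"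
proof -
  obtain a b where "- t < (real a - real b) / real q" "(real a - real b) / real q \<le> - t + 1 / real q"
    using approx_above[OF assms, of "- t"] .
  moreover have "(real b - real a) / real q = - ((real a - real b) / real q)"
    by (simp add: minus_divide_left)
  ultimately show thesis using that[of b a] by linarith
qed

text \<open>The error \<open>2 / real q\<close> covers two roundings to multiples of
  \<open>1 / real q\<close>, as in the proof of additivity.\<close>

lemma le_if_approx:
  fixes r s :: real
  assumes "\<And>q::nat. 0 < q \<Longrightarrow> r \<le> s + 2 / real q"
  shows "r \<le> s"
proof (rule ccontr)
  assume "\<not> r \<le> s"
  then obtain n where "inverse (real (Suc n)) < (r - s) / 2" using reals_Archimedean[of "(r - s) / 2"] by auto
  then show False using assms[of "Suc n"] by (simp add: field_simps)
qed

lemma char_mono: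
  assumes xy: "below x y" and E: "x \<in> E" "y \<in> E"
  shows "char x \<le> char y"
proof (rule le_if_approx)
  fix q :: nat assume q: "0 < q"
  obtain a b where ab: "char y < (real a - real b) / real q"
    "(real a - real b) / real q \<le> char y + 1 / real q" using approx_above[OF q] .
  have "below (mul q x \<oplus> mul b \<one>) (mul q y \<oplus> mul b \<one>)"
    using xy E by (intro below_add below_mul) auto
  then have "below (mul q x \<oplus> mul b \<one>) (mul a \<one>)"
    using char_less[OF E(2) q ab(1)] E below_trans[of "mul q x \<oplus> mul b \<one>" "mul q y \<oplus> mul b \<one>" "mul a \<one>"]
    by simp
  then have "char x \<le> (real a - real b) / real q" by (rule char_le[OF E(1) q])
  also have "\<dots> \<le> char y + 1 / real q" by fact
  finally show "char x \<le> char y + 2 / real q"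
    using divide_right_mono[of 1 2 "real q"] by simp
qed

text \<open>Round both values up, respectively down, to fractions with the same denominator
  \<open>q\<close>; the corresponding cut inequalities add.\<close>

lemma char_add:
  assumes E: "x \<in> E" "y \<in> E"
  shows "char (x \<oplus> y) = char x + char y"
proof (rule antisym)
  have eq: "mul q (x \<oplus> y) \<oplus> mul (b + d) \<one> = (mul q x \<oplus> mul b \<one>) \<oplus> (mul q y \<oplus> mul d \<one>)" for q b d
    using E by (simp add: mul_sum mul_add add_ac)
  have xy: "x \<oplus> y \<in> E" using E by simp
  show "char (x \<oplus> y) \<le> char x + char y"
  proof (rule le_if_approx)
    fix q :: nat assume q: "0 < q"
    obtain a b where ab: "char x < (real a - real b) / real q"
      "(real a - real b) / real q \<le> char x + 1 / real q" using approx_above[OF q] .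
    obtain c d where cd: "char y < (real c - real d) / real q"
      "(real c - real d) / real q \<le> char y + 1 / real q" using approx_above[OF q] .
    have "below (mul q (x \<oplus> y) \<oplus> mul (b + d) \<one>) (mul (a + c) \<one>)"
      unfolding eq using char_less[OF E(1) q ab(1)] char_less[OF E(2) q cd(1)] E
      by (simp add: mul_add below_add)
    then have "char (x \<oplus> y) \<le> (real (a + c) - real (b + d)) / real q" by (rule char_le[OF xy q])
    also have "\<dots> = (real a - real b) / real q + (real c - real d) / real q"
      by (simp add: add_divide_distrib[symmetric])
    finally show "char (x \<oplus> y) \<le> char x + char y + 2 / real q"
      using ab cd add_divide_distrib[of 1 1 "real q"] by linarith
  qed
  show "char x + char y \<le> char (x \<oplus> y)"
  proof (rule le_if_approx)
    fix q :: nat assume q: "0 < q"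
    obtain a b where ab: "(real a - real b) / real q < char x"
      "char x - 1 / real q \<le> (real a - real b) / real q" using approx_below[OF q] .
    obtain c d where cd: "(real c - real d) / real q < char y"
      "char y - 1 / real q \<le> (real c - real d) / real q" using approx_below[OF q] .
    have "below (mul (a + c) \<one>) (mul q (x \<oplus> y) \<oplus> mul (b + d) \<one>)"
      unfolding eq using less_char[OF E(1) q ab(1)] less_char[OF E(2) q cd(1)] E
      by (simp add: mul_add below_add)
    then have "(real (a + c) - real (b + d)) / real q \<le> char (x \<oplus> y)" by (rule le_char[OF xy q])
    moreover have "(real (a + c) - real (b + d)) / real q = (real a - real b) / real q + (real c - real d) / real q"
      by (simp add: add_divide_distrib[symmetric])
    ultimately show "char x + char y \<le> char (x \<oplus> y) + 2 / real q"
      using ab cd add_divide_distrib[of 1 1 "real q"] by linarith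
  qed
qed

lemma char_zero: "char \<zero> = 0"
  using char_add[of \<zero> \<zero>] by simp

lemma char_neg: "x \<in> E \<Longrightarrow> char (\<ominus> x) = - char x"
  using char_add[of x "\<ominus> x"] char_zero by simp

lemma char_one: "char \<one> = 1"
  using char_le[of \<one> 1 0 1] le_char[of \<one> 1 1 0] by simp

lemma char_le_mono: "x \<preceq> y \<Longrightarrow> x \<in> E \<Longrightarrow> y \<in> E \<Longrightarrow> char x \<le> char y"
  by (simp add: char_mono le_imp_below)

text \<open>The positive part \<open>?p\<close> of \<open>x - y\<close> lies in the cone and
  dominates both \<open>(x \<squnion> y) - y\<close> and
  \<open>x - (x \<sqinter> y)\<close>.\<close>

lemma below_join:
  assumes xy: "below x y" and E: "x \<in> E" "y \<in> E"
  shows "below (x \<squnion> y) y" "below x (x \<sqinter> y)"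
proof -
  let ?p = "(x \<oplus> \<ominus> y) \<squnion> \<zero>"
  have p: "N ?p" "?p \<in> C" "\<zero> \<preceq> ?p" using xy N_pos E by (auto simp: below_def)
  have xp: "x \<preceq> ?p \<oplus> y" using diff_le_iff[of x y ?p] E by simp
  moreover have yp: "y \<preceq> ?p \<oplus> y" using add_mono[of \<zero> ?p y y] E p by simp
  ultimately have "x \<squnion> y \<preceq> ?p \<oplus> y" using E by (intro join_le) auto
  then have "(x \<squnion> y) \<oplus> \<ominus> y \<preceq> ?p" using E by (simp add: diff_le_iff)
  then show "below (x \<squnion> y) y" unfolding below_def using N_le[OF p(1)] E by simp
  have "x \<oplus> \<ominus> ?p \<preceq> x" using p E by (intro diff_le_self) auto
  moreover have "x \<oplus> \<ominus> ?p \<preceq> y" using xp E p by (simp add: diff_le_iff add_comm)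
  ultimately have "x \<oplus> \<ominus> ?p \<preceq> x \<sqinter> y" using E p by (intro le_meet) auto
  then have "x \<oplus> \<ominus> (x \<sqinter> y) \<preceq> ?p" using E p by (simp add: diff_le_iff add_comm)
  then show "below x (x \<sqinter> y)" unfolding below_def using N_le[OF p(1)] E by simp
qed

lemma char_join_meet_below:
  assumes xy: "below x y" and E: "x \<in> E" "y \<in> E"
  shows "char (x \<squnion> y) = char y" "char (x \<sqinter> y) = char x"
proof -
  show "char (x \<squnion> y) = char y"
    using char_mono[OF below_join(1)[OF assms]] char_le_mono[of y "x \<squnion> y"] E by simp
  show "char (x \<sqinter> y) = char x"
    using char_mono[OF below_join(2)[OF assms]] char_le_mono[of "x \<sqinter> y" x] E by simp
qed

lemma char_join_meet:
  assumes E: "x \<in> E" "y \<in> E"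
  shows "char (x \<squnion> y) = max (char x) (char y)" "char (x \<sqinter> y) = min (char x) (char y)"
proof -
  have "char (x \<squnion> y) = max (char x) (char y) \<and> char (x \<sqinter> y) = min (char x) (char y)"
    using below_total[OF E]
  proof
    assume xy: "below x y"
    then show ?thesis using char_join_meet_below[OF xy E] char_mono[OF xy E] by simp
  next
    assume yx: "below y x"
    then show ?thesis
      using char_join_meet_below[OF yx E(2,1)] char_mono[OF yx E(2,1)] E
      by (simp add: join_comm[of x y] meet_comm[of x y])
  qed
  then show "char (x \<squnion> y) = max (char x) (char y)" "char (x \<sqinter> y) = min (char x) (char y)" by auto
qed

lemma char_sum_along:
  assumes u: "range u \<subseteq> E" and r: "\<And>n. r \<le> char (u n)"
  shows "sum_along u ns \<in> E \<and> real (length ns) * r \<le> char (sum_along u ns)"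
proof (induction ns)
  case Nil
  then show ?case by (simp add: char_zero)
next
  case (Cons n ns)
  have "u n \<in> E" using u by auto
  then show ?case using Cons r[of n] by (simp add: char_add algebra_simps)
qed

text \<open>If the values of the truncated terms stayed below some \<open>y\<close> less than the
  value of the supremum, every gap would have value at least a fixed positive real. Then
  \<open>m\<close> gaps would sum to more than 1 for large \<open>m\<close>, but the generic
  condition supplies \<open>m\<close> gaps with sum at most \<open>\<one>\<close>.\<close>

lemma char_bjoin:
  assumes g: "g \<in> E" "range f \<subseteq> E" "sg_bjoin G g f \<in> E"
    and gen: "\<And>m. \<exists>ns. length ns = m \<and>
      N (sum_along (\<lambda>n. sg_bjoin G g f \<oplus> \<ominus> (f n \<sqinter> g)) ns \<oplus> \<ominus> \<one>)"
  shows "char (sg_bjoin G g f) = Sup (range (\<lambda>n. min (char (f n)) (char g)))"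
proof -
  let ?s = "sg_bjoin G g f"
  let ?u = "\<lambda>n. ?s \<oplus> \<ominus> (f n \<sqinter> g)"
  have f: "f n \<in> E" for n using g by auto
  have fg: "range f \<subseteq> C" using g(2) E_sub by blast
  have "Sup (range (\<lambda>n. min (char (f n)) (char g))) = char ?s"
  proof (rule cSup_eq_non_empty)
    fix r assume "r \<in> range (\<lambda>n. min (char (f n)) (char g))"
    then obtain n where "r = char (f n \<sqinter> g)" using f g by (auto simp: char_join_meet)
    then show "r \<le> char ?s" using le_bjoin[of g f n] fg f g by (simp add: char_le_mono)
  next
    fix y assume y: "\<And>r. r \<in> range (\<lambda>n. min (char (f n)) (char g)) \<Longrightarrow> r \<le> y"
    show "char ?s \<le> y"
    proof (rule ccontr)
      assume "\<not> char ?s \<le> y"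
      then obtain m :: nat where m: "real m * (char ?s - y) > 1"
        using ex_less_of_nat_mult[of "char ?s - y" 1] by auto
      have "char ?s - y \<le> char (?u n)" for n
        using y[of "min (char (f n)) (char g)"] f g by (simp add: char_add char_neg char_join_meet)
      moreover have "range ?u \<subseteq> E" using f g by auto
      moreover obtain ns where ns: "length ns = m" "below (sum_along ?u ns) \<one>"
        using gen[of m] unfolding below_def by blast
      ultimately have "sum_along ?u ns \<in> E" "real m * (char ?s - y) \<le> char (sum_along ?u ns)"
        using char_sum_along[of ?u "char ?s - y" ns] by auto
      moreover from this have "char (sum_along ?u ns) \<le> 1"
        using char_mono[OF ns(2)] by (simp add: char_one)
      ultimately show False using m by simp
    qed
  qed simp
  then show ?thesis ..
qed

lemma char_pos:
  assumes "d \<in> E" "N (\<one> \<oplus> \<ominus> mul m d)"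
  shows "0 < char d"
proof -
  have m: "0 < m" using assms(2) N_one by (cases m) auto
  have "below (mul 1 \<one>) (mul m d \<oplus> mul 0 \<one>)" using assms by (simp add: below_def)
  from le_char[OF assms(1) m this] have "1 / real m \<le> char d" by simp
  then show ?thesis using m by (smt (verit) divide_pos_pos of_nat_0_less_iff)
qed

end

subsection \<open>Separating valuations\<close>

context sgu_variety
begin

fun stage :: "'a set \<Rightarrow> nat \<Rightarrow> 'a set" where
  "stage D 0 = insert \<zero> (insert \<one> D)"
| "stage D (Suc n) = stage D n \<union> sg_neg G ` stage D n
     \<union> (\<lambda>(x, y). x \<oplus> y) ` (stage D n \<times> stage D n)
     \<union> (\<lambda>(x, y). x \<squnion> y) ` (stage D n \<times> stage D n)
     \<union> (\<lambda>(x, y). x \<sqinter> y) ` (stage D n \<times> stage D n)"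

lemma stage_mono: "m \<le> n \<Longrightarrow> stage D m \<subseteq> stage D n"
  by (rule lift_Suc_mono_le[of "stage D"]) auto

lemma stage_sub: "D \<subseteq> C \<Longrightarrow> stage D n \<subseteq> C"
  by (induction n) auto

lemma stage_countable: "countable D \<Longrightarrow> countable (stage D n)"
  by (induction n) auto

lemma countable_closure:
  assumes "countable D" "D \<subseteq> C"
  obtains E where "D \<subseteq> E" "E \<subseteq> C" "countable E" "\<zero> \<in> E" "\<one> \<in> E"
    "\<And>x. x \<in> E \<Longrightarrow> \<ominus> x \<in> E"
    "\<And>x y. x \<in> E \<Longrightarrow> y \<in> E \<Longrightarrow> x \<oplus> y \<in> E \<and> x \<squnion> y \<in> E \<and> x \<sqinter> y \<in> E"
proof -
  let ?E = "\<Union>n. stage D n"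
  have 0: "stage D 0 \<subseteq> ?E" by blast
  show thesis
  proof (rule that[of ?E])
    show "D \<subseteq> ?E" "\<zero> \<in> ?E" "\<one> \<in> ?E" using 0 by auto
    show "?E \<subseteq> C" using stage_sub[OF assms(2)] by blast
    show "countable ?E" using stage_countable[OF assms(1)] by simp
    show "\<ominus> x \<in> ?E" if "x \<in> ?E" for x
    proof -
      from that obtain n where "x \<in> stage D n" by blast
      then have "\<ominus> x \<in> stage D (Suc n)" by simp
      then show ?thesis by blast
    qed
    show "x \<oplus> y \<in> ?E \<and> x \<squnion> y \<in> ?E \<and> x \<sqinter> y \<in> ?E" if xy: "x \<in> ?E" "y \<in> ?E" for x y
    proof -
      from xy obtain m n where "x \<in> stage D m" "y \<in> stage D n" by blast
      then have "x \<in> stage D (max m n)" "y \<in> stage D (max m n)"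
        using stage_mono[of m "max m n" D] stage_mono[of n "max m n" D] by auto
      then have "(x, y) \<in> stage D (max m n) \<times> stage D (max m n)" by simp
      then have "x \<oplus> y \<in> stage D (Suc (max m n)) \<and> x \<squnion> y \<in> stage D (Suc (max m n))
          \<and> x \<sqinter> y \<in> stage D (Suc (max m n))"
        unfolding stage.simps by force
      then show ?thesis by blast
    qed
  qed
qed

text \<open>The homomorphism conditions are asked only for arguments in \<open>D\<close> and for the
  instances of the infinitary operation listed in \<open>B\<close>.\<close>

definition preserves :: "'a set \<Rightarrow> ('a \<times> (nat \<Rightarrow> 'a)) set \<Rightarrow> ('a \<Rightarrow> real) \<Rightarrow> bool" where
  "preserves D B v \<longleftrightarrow> v \<zero> = 0 \<and> v \<one> = 1 \<and>
    (\<forall>x\<in>D. v (\<ominus> x) = - v x) \<and>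
    (\<forall>x\<in>D. \<forall>y\<in>D. v (x \<oplus> y) = v x + v y \<and> v (x \<squnion> y) = max (v x) (v y) \<and>
      v (x \<sqinter> y) = min (v x) (v y)) \<and>
    (\<forall>(g, f)\<in>B. v (sg_bjoin G g f) = Sup (range (\<lambda>n. min (v (f n)) (v g))))"

lemma preserves_mono: "preserves D' B' v \<Longrightarrow> D \<subseteq> D' \<Longrightarrow> B \<subseteq> B' \<Longrightarrow> preserves D B v"
  unfolding preserves_def by blast

definition admissible :: "'a set \<Rightarrow> ('a \<times> (nat \<Rightarrow> 'a)) set \<Rightarrow> bool" where
  "admissible D B \<longleftrightarrow> countable D \<and> D \<subseteq> C \<and> countable B \<and> (\<forall>(g, f)\<in>B. g \<in> C \<and> range f \<subseteq> C)"

text \<open>A lower bound \<open>e\<close> of the gaps makes \<open>?s - e\<close> an upper bound of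
  the truncated terms, hence at least \<open>?s\<close>.\<close>

lemma inf_zero_bjoin:
  assumes g: "g \<in> C" and f: "range f \<subseteq> C"
  shows "inf_zero (\<lambda>n. sg_bjoin G g f \<oplus> \<ominus> (f n \<sqinter> g))"
  unfolding inf_zero_def
proof (intro conjI allI ballI impI)
  let ?s = "sg_bjoin G g f"
  have fn: "f n \<in> C" for n using f by auto
  have s: "?s \<in> C" using g f by simp
  show "range (\<lambda>n. ?s \<oplus> \<ominus> (f n \<sqinter> g)) \<subseteq> C" using g fn s by auto
  show "\<zero> \<preceq> ?s \<oplus> \<ominus> (f n \<sqinter> g)" for n
    using le_bjoin[OF g f, of n] g fn s by (simp add: le_diff_iff)
  fix e assume e: "e \<in> C" "\<forall>n. e \<preceq> ?s \<oplus> \<ominus> (f n \<sqinter> g)"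
  have "?s \<preceq> ?s \<oplus> \<ominus> e"
  proof (rule bjoin_le[OF g f])
    show "f n \<sqinter> g \<preceq> ?s \<oplus> \<ominus> e" for n
      using e g fn s by (simp add: le_diff_iff add_comm[of e])
  qed (use e s in simp)
  then have "?s \<oplus> e \<preceq> ?s" using e s by (simp add: le_diff_iff)
  then show "e \<preceq> \<zero>" using add_left_mono[of "?s \<oplus> e" ?s "\<ominus> ?s"] e s by simp
qed

lemma separating_valuation:
  assumes DB: "admissible D B" and d: "d \<in> C" "\<not> d \<preceq> \<zero>"
  obtains v where "preserves D B v" "0 < v d"
proof -
  \<comment> \<open>All arguments and results of the listed infinitary operations must lie in the
    countable subalgebra on which the character is well behaved.\<close>
  let ?D = "insert d (D \<union> fst ` B \<union> (\<Union>(g, f)\<in>B. range f) \<union> (\<lambda>(g, f). sg_bjoin G g f) ` B)"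
  have B: "g \<in> C" "range f \<subseteq> C" if "(g, f) \<in> B" for g f
    using DB that unfolding admissible_def by blast+
  have Bf: "f n \<in> C" if "(g, f) \<in> B" for g f n
    using B(2)[OF that] by auto
  have "countable ?D" using DB by (auto simp: admissible_def)
  moreover have "?D \<subseteq> C" using DB d by (auto simp: admissible_def intro: B Bf)
  ultimately obtain E where E: "?D \<subseteq> E" "E \<subseteq> C" "countable E" "\<zero> \<in> E" "\<one> \<in> E"
    "\<And>x. x \<in> E \<Longrightarrow> \<ominus> x \<in> E"
    "\<And>x y. x \<in> E \<Longrightarrow> y \<in> E \<Longrightarrow> x \<oplus> y \<in> E \<and> x \<squnion> y \<in> E \<and> x \<sqinter> y \<in> E"
    by (rule countable_closure) (rule that; simp)
  let ?u = "\<lambda>(g, f) n. sg_bjoin G g f \<oplus> \<ominus> (f n \<sqinter> g)"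
  have U: "countable (?u ` B)" "\<And>u. u \<in> ?u ` B \<Longrightarrow> inf_zero u"
    using DB inf_zero_bjoin by (auto simp: admissible_def)
  \<comment> \<open>A condition must be nonnegative, so \<open>d\<close> is replaced by its positive
    part; positivity of the value of that part gives positivity of the value of
    \<open>d\<close>.\<close>
  have "cond (d \<squnion> \<zero>)"
    using d le_trans[of d "d \<squnion> \<zero>" \<zero>] by (auto simp: cond_def)
  from generic_cone[OF E(2-7) U this] obtain N where N: "sgu_cone G E N"
    "\<And>u m. u \<in> ?u ` B \<Longrightarrow> \<exists>ns. length ns = m \<and> N (sum_along u ns \<oplus> \<ominus> \<one>)"
    "\<exists>m. N (\<one> \<oplus> \<ominus> mul m (d \<squnion> \<zero>))" by blast
  interpret N: sgu_cone G E N by (rule N(1))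
  have dE: "d \<in> E" using E(1) by blast
  have "0 < N.char (d \<squnion> \<zero>)" using N(3) N.char_pos dE by auto
  then have pos: "0 < N.char d" using dE by (simp add: N.char_join_meet N.char_zero)
  have "N.char (sg_bjoin G g f) = Sup (range (\<lambda>n. min (N.char (f n)) (N.char g)))"
    if gf: "(g, f) \<in> B" for g f
  proof (rule N.char_bjoin)
    have "g \<in> fst ` B" "range f \<subseteq> (\<Union>(g, f)\<in>B. range f)"
      "sg_bjoin G g f \<in> (\<lambda>(g, f). sg_bjoin G g f) ` B"
      using gf by (force, blast, force)
    then show "g \<in> E" "range f \<subseteq> E" "sg_bjoin G g f \<in> E"
      using E(1) unfolding insert_subset Un_subset_iff by (meson subset_trans subsetD)+
    show "\<exists>ns. length ns = m \<and> N (sum_along (\<lambda>n. sg_bjoin G g f \<oplus> \<ominus> (f n \<sqinter> g)) ns \<oplus> \<ominus> \<one>)" for m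
      using N(2)[OF imageI[OF gf], of m] by simp
  qed
  moreover have "D \<subseteq> E" using E(1) by blast
  ultimately have "preserves D B N.char"
    unfolding preserves_def
    by (auto simp: N.char_zero N.char_one N.char_neg N.char_add N.char_join_meet subset_iff)
  then show thesis using pos that by blast
qed

lemma le_if_valuations_agree:
  assumes DB: "admissible D B" and x: "x \<in> C" and y: "y \<in> C"
    and agree: "\<And>v. preserves D B v \<Longrightarrow> v x = v y"
  shows "x \<preceq> y"
proof (rule ccontr)
  assume "\<not> x \<preceq> y"
  then have "\<not> x \<oplus> \<ominus> y \<preceq> \<zero>" using x y by (simp add: diff_le_zero_iff)
  \<comment> \<open>Enlarging \<open>D\<close> forces
    \<open>v (x \<oplus> \<ominus> y) = v x - v y\<close>, and it only restricts the valuations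
    considered.\<close>
  moreover have "admissible (D \<union> {x, y, \<ominus> y}) B" using DB x y by (simp add: admissible_def)
  ultimately obtain v where v: "preserves (D \<union> {x, y, \<ominus> y}) B v" "0 < v (x \<oplus> \<ominus> y)"
    using separating_valuation x y by (metis closed(3,6))
  from v(1) have "v (x \<oplus> \<ominus> y) = v x - v y" by (simp add: preserves_def)
  moreover have "v x = v y" using v(1) by (intro agree) (auto elim: preserves_mono)
  ultimately show False using v(2) by simp
qed

subsection \<open>The quotient of the power\<close>

text \<open>The index \<open>X\<close> stands for the valuation \<open>rep X\<close>. Two functions are identified if they
  agree at all valuations that satisfy some countably many instances of the homomorphism
  conditions.\<close>

definition theta :: "((('a \<Rightarrow> real) set \<Rightarrow> real) \<times> (('a \<Rightarrow> real) set \<Rightarrow> real)) set" where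
  "theta = {(P, Q). \<exists>D B. admissible D B \<and> (\<forall>X. preserves D B (rep X) \<longrightarrow> P X = Q X)}"

definition ev :: "'a \<Rightarrow> ('a \<Rightarrow> real) set \<Rightarrow> real" where
  "ev x X = rep X x"

lemma thetaI:
  "admissible D B \<Longrightarrow> (\<And>X. preserves D B (rep X) \<Longrightarrow> P X = Q X) \<Longrightarrow> (P, Q) \<in> theta"
  unfolding theta_def by blast

text \<open>Countably many countable sets of conditions have a countable union. This is what makes
  \<open>theta\<close> compatible with an operation of countably infinite arity.\<close>

lemma theta_countably:
  assumes "\<And>n::nat. (P n, Q n) \<in> theta" "\<And>X. (\<And>n. P n X = Q n X) \<Longrightarrow> S X = T X"
  shows "(S, T) \<in> theta"
proof -
  have "\<forall>n. \<exists>DB. admissible (fst DB) (snd DB) \<and>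
      (\<forall>X. preserves (fst DB) (snd DB) (rep X) \<longrightarrow> P n X = Q n X)"
    using assms(1) unfolding theta_def by fastforce
  from choice[OF this] obtain DB where DB: "\<And>n. admissible (fst (DB n)) (snd (DB n))"
    "\<And>n X. preserves (fst (DB n)) (snd (DB n)) (rep X) \<Longrightarrow> P n X = Q n X"
    by auto
  let ?D = "\<Union>n. fst (DB n)" and ?B = "\<Union>n. snd (DB n)"
  show ?thesis
  proof (rule thetaI[of ?D ?B])
    show "admissible ?D ?B" using DB(1) by (fastforce simp: admissible_def)
    fix X assume X: "preserves ?D ?B (rep X)"
    have "preserves (fst (DB n)) (snd (DB n)) (rep X)" for n
      by (rule preserves_mono[OF X]) auto
    then show "S X = T X" using DB(2) by (intro assms(2)) auto
  qed
qed

lemma theta_binary: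
  assumes "(P, P') \<in> theta" "(Q, Q') \<in> theta" "\<And>X. P X = P' X \<Longrightarrow> Q X = Q' X \<Longrightarrow> S X = T X"
  shows "(S, T) \<in> theta"
proof (rule theta_countably)
  show "(if n = 0 then P else Q, if n = 0 then P' else Q') \<in> theta" for n :: nat
    using assms by simp
  fix X assume *: "\<And>n::nat. (if n = 0 then P else Q) X = (if n = 0 then P' else Q') X"
  show "S X = T X" using assms(3) *[of 0] *[of 1] by simp
qed

lemma theta_unary:
  "(P, P') \<in> theta \<Longrightarrow> (\<And>X. P X = P' X \<Longrightarrow> S X = T X) \<Longrightarrow> (S, T) \<in> theta"
  using theta_binary[of P P' P P'] by simp

lemma theta_refl: "(P, P) \<in> theta"
  by (rule thetaI[of "{}" "{}"]) (auto simp: admissible_def)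

lemma theta_equiv: "equiv UNIV theta"
proof (rule equivI)
  show "refl theta" by (rule refl_onI) (simp_all add: theta_refl)
  show "sym theta" by (rule symI) (erule theta_unary, simp)
  show "trans theta" by (rule transI) (erule (1) theta_binary, simp)
qed simp

lemma theta_congruence: "congruence R_power theta"
proof -
  have "equiv (sg_carrier R_power) theta" using theta_equiv by (simp add: R_power_def)
  moreover have "(sg_add R_power x y, sg_add R_power x' y') \<in> theta \<and>
      (sg_join R_power x y, sg_join R_power x' y') \<in> theta \<and>
      (sg_meet R_power x y, sg_meet R_power x' y') \<in> theta"
    if "(x, x') \<in> theta" "(y, y') \<in> theta" for x x' y y'
    by (intro conjI; rule theta_binary[OF that]; simp add: R_power_def)
  moreover have "(sg_neg R_power x, sg_neg R_power x') \<in> theta" if "(x, x') \<in> theta" for x x'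
    by (rule theta_unary[OF that]) (simp add: R_power_def)
  moreover have "(sg_bjoin R_power g f, sg_bjoin R_power g' f') \<in> theta"
    if g: "(g, g') \<in> theta" and f: "\<forall>n. (f n, f' n) \<in> theta" for g g' f f'
  proof (rule theta_countably)
    \<comment> \<open>The bound \<open>g\<close> is placed in front of the sequence
      \<open>f\<close>, so that a single sequence carries all arguments.\<close>
    show "(case_nat g f n, case_nat g' f' n) \<in> theta" for n
      using g f by (cases n) auto
    fix X assume *: "\<And>n. case_nat g f n X = case_nat g' f' n X"
    show "sg_bjoin R_power g f X = sg_bjoin R_power g' f' X"
      using *[of 0] *[of "Suc _"] by (simp add: R_power_def)
  qed
  ultimately show ?thesis unfolding congruence_def by simp
qed

end

section \<open>The evaluation embedding\<close>

lemma rep_class: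
  assumes "equiv A \<theta>" "x \<in> A"
  shows "(x, rep (\<theta> `` {x})) \<in> \<theta>"
proof -
  have "x \<in> \<theta> `` {x}" using assms by (rule equiv_class_self)
  then have "rep (\<theta> `` {x}) \<in> \<theta> `` {x}" unfolding rep_def by (rule someI)
  then show ?thesis by simp
qed

context sgu_variety
begin

definition cls :: "'a \<Rightarrow> (('a \<Rightarrow> real) set \<Rightarrow> real) set" where
  "cls x = theta `` {ev x}"

lemma cls_eqI: "(ev x, P) \<in> theta \<Longrightarrow> (P, Q) \<in> theta \<Longrightarrow> cls x = theta `` {Q}"
  unfolding cls_def by (rule equiv_class_eq[OF theta_equiv]) (erule (1) theta_binary, simp)

lemma rep_cls: "(ev x, rep (cls x)) \<in> theta"
  unfolding cls_def by (rule rep_class[OF theta_equiv]) simp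

text \<open>Each identity involves only finitely many elements or one instance of the infinitary
  operation, so an admissible pair of sets forces it for the evaluations. The congruence property
  then passes from evaluations to the chosen representatives.\<close>

lemma cls_ops:
  shows "cls \<zero> = sg_zero (quot R_power theta)"
    and "cls \<one> = sg_one (quot R_power theta)"
    and "x \<in> C \<Longrightarrow> cls (\<ominus> x) = sg_neg (quot R_power theta) (cls x)"
    and "x \<in> C \<Longrightarrow> y \<in> C \<Longrightarrow> cls (x \<oplus> y) = sg_add (quot R_power theta) (cls x) (cls y)"
    and "x \<in> C \<Longrightarrow> y \<in> C \<Longrightarrow> cls (x \<squnion> y) = sg_join (quot R_power theta) (cls x) (cls y)"
    and "x \<in> C \<Longrightarrow> y \<in> C \<Longrightarrow> cls (x \<sqinter> y) = sg_meet (quot R_power theta) (cls x) (cls y)"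
    and "g \<in> C \<Longrightarrow> range f \<subseteq> C \<Longrightarrow>
      cls (sg_bjoin G g f) = sg_bjoin (quot R_power theta) (cls g) (\<lambda>n. cls (f n))"
proof -
  have empty: "admissible {} {}" by (simp add: admissible_def)
  show "cls \<zero> = sg_zero (quot R_power theta)"
    unfolding quot_def sgu.simps
    by (rule cls_eqI[OF thetaI[OF empty] theta_refl]) (simp add: ev_def preserves_def R_power_def)
  show "cls \<one> = sg_one (quot R_power theta)"
    unfolding quot_def sgu.simps
    by (rule cls_eqI[OF thetaI[OF empty] theta_refl]) (simp add: ev_def preserves_def R_power_def)
  show "cls (\<ominus> x) = sg_neg (quot R_power theta) (cls x)" if x: "x \<in> C"
  proof -
    have "(ev (\<ominus> x), sg_neg R_power (ev x)) \<in> theta"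
      by (rule thetaI[of "{x}" "{}"])
        (use x in \<open>auto simp: ev_def preserves_def R_power_def admissible_def\<close>)
    moreover have "(sg_neg R_power (ev x), sg_neg R_power (rep (cls x))) \<in> theta"
      by (rule theta_unary[OF rep_cls]) (simp add: R_power_def)
    ultimately show ?thesis unfolding quot_def sgu.simps by (rule cls_eqI)
  qed
  { assume xy: "x \<in> C" "y \<in> C"
    then have adm: "admissible {x, y} {}" by (simp add: admissible_def)
    have "(ev (x \<oplus> y), sg_add R_power (ev x) (ev y)) \<in> theta"
      by (rule thetaI[OF adm]) (simp add: ev_def preserves_def R_power_def)
    moreover have
      "(sg_add R_power (ev x) (ev y), sg_add R_power (rep (cls x)) (rep (cls y))) \<in> theta"
      by (rule theta_binary[OF rep_cls[of x] rep_cls[of y]]) (simp add: R_power_def)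
    ultimately show "cls (x \<oplus> y) = sg_add (quot R_power theta) (cls x) (cls y)"
      unfolding quot_def sgu.simps by (rule cls_eqI)
    have "(ev (x \<squnion> y), sg_join R_power (ev x) (ev y)) \<in> theta"
      by (rule thetaI[OF adm]) (simp add: ev_def preserves_def R_power_def)
    moreover have
      "(sg_join R_power (ev x) (ev y), sg_join R_power (rep (cls x)) (rep (cls y))) \<in> theta"
      by (rule theta_binary[OF rep_cls[of x] rep_cls[of y]]) (simp add: R_power_def)
    ultimately show "cls (x \<squnion> y) = sg_join (quot R_power theta) (cls x) (cls y)"
      unfolding quot_def sgu.simps by (rule cls_eqI)
    have "(ev (x \<sqinter> y), sg_meet R_power (ev x) (ev y)) \<in> theta"
      by (rule thetaI[OF adm]) (simp add: ev_def preserves_def R_power_def)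
    moreover have
      "(sg_meet R_power (ev x) (ev y), sg_meet R_power (rep (cls x)) (rep (cls y))) \<in> theta"
      by (rule theta_binary[OF rep_cls[of x] rep_cls[of y]]) (simp add: R_power_def)
    ultimately show "cls (x \<sqinter> y) = sg_meet (quot R_power theta) (cls x) (cls y)"
      unfolding quot_def sgu.simps by (rule cls_eqI) }
  show "cls (sg_bjoin G g f) = sg_bjoin (quot R_power theta) (cls g) (\<lambda>n. cls (f n))"
    if gf: "g \<in> C" "range f \<subseteq> C"
  proof -
    have "(ev (sg_bjoin G g f), sg_bjoin R_power (ev g) (\<lambda>n. ev (f n))) \<in> theta"
      by (rule thetaI[of "{}" "{(g, f)}"])
        (use gf in \<open>auto simp: ev_def preserves_def R_power_def R_alg_def admissible_def\<close>)
    moreover have "(sg_bjoin R_power (ev g) (\<lambda>n. ev (f n)),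
        sg_bjoin R_power (rep (cls g)) (\<lambda>n. rep (cls (f n)))) \<in> theta"
      using theta_congruence rep_cls unfolding congruence_def by simp
    ultimately show ?thesis unfolding quot_def sgu.simps by (rule cls_eqI)
  qed
qed

text \<open>Equal classes mean that the evaluations agree at all valuations preserving some
  admissible \<open>D\<close> and \<open>B\<close>; these valuations suffice to compare elements, in
  both directions.\<close>

lemma cls_inj: "inj_on cls C"
proof (rule inj_onI)
  fix x y assume xy: "x \<in> C" "y \<in> C" "cls x = cls y"
  then have "(ev x, ev y) \<in> theta"
    unfolding cls_def by (intro eq_equiv_class[OF _ theta_equiv]) simp_all
  then obtain D B where DB: "admissible D B" "\<And>X. preserves D B (rep X) \<Longrightarrow> ev x X = ev y X"
    unfolding theta_def by blast
  \<comment> \<open>The singleton serves as an index for \<open>v\<close>, so every valuation is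
    represented.\<close>
  have rep: "rep {v} = v" for v :: "'a \<Rightarrow> real" by (simp add: rep_def)
  have v: "v x = v y" if "preserves D B v" for v
    using DB(2)[of "{v}"] that by (simp add: ev_def rep)
  have "x \<preceq> y" using xy v by (intro le_if_valuations_agree[OF DB(1)])
  moreover have "y \<preceq> x" using xy v[symmetric] by (intro le_if_valuations_agree[OF DB(1)])
  ultimately show "x = y" using xy by (intro le_antisym)
qed

lemma cls_subalg: "subalg (cls ` C) (quot R_power theta)"
proof -
  let ?Q = "quot R_power theta"
  have carrier: "cls ` C \<subseteq> sg_carrier ?Q"
    by (auto simp: quot_def R_power_def cls_def intro: quotientI)
  have "sg_bjoin ?Q X F \<in> cls ` C" if X: "X \<in> cls ` C" and F: "range F \<subseteq> cls ` C" for X F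
  proof -
    obtain g where g: "g \<in> C" "X = cls g" using X by blast
    have "\<forall>n. \<exists>x. x \<in> C \<and> F n = cls x" using F by blast
    then obtain f where f: "\<And>n. f n \<in> C" "\<And>n. F n = cls (f n)" by metis
    then have "F = (\<lambda>n. cls (f n))" by blast
    moreover have r: "range f \<subseteq> C" using f by blast
    ultimately have "sg_bjoin ?Q X F = cls (sg_bjoin G g f)" using g cls_ops(7) by simp
    then show ?thesis using g r by simp
  qed
  then have "sg_closed ?Q (cls ` C)"
    unfolding sg_closed_def by (auto simp: cls_ops(1-6)[symmetric])
  then show ?thesis using carrier unfolding subalg_def by blast
qed

lemma cls_iso: "iso G ((quot R_power theta)\<lparr>sg_carrier := cls ` C\<rparr>) cls"
  unfolding iso_def hom_def using cls_inj by (auto simp: cls_ops bij_betw_def)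

end

theorem mainTheorem13:
  fixes G :: "('a, 'b) sgu_scheme"
  assumes "in_V G"
  shows "\<exists>(\<theta> :: ((('a \<Rightarrow> real) set \<Rightarrow> real) \<times> (('a \<Rightarrow> real) set \<Rightarrow> real)) set) C h.
           congruence R_power \<theta> \<and>
           subalg C (quot R_power \<theta>) \<and>
           iso G ((quot R_power \<theta>)\<lparr>sg_carrier := C\<rparr>) h"
proof -
  interpret sgu_variety G by unfold_locales (rule assms)
  show ?thesis using theta_congruence cls_subalg cls_iso by blast
qed

end
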